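(* Let $k$ be a commutative ring and let $\mathcal{A}$ be a right Auslander-Reiten $k$-category (in particular Krull-Schmidt). Let $f\colon X\to Y$ be a morphism in $\mathcal{A}$ and let $\mathcal{I}$ be an admissible ideal of $\mathcal{A}$. Suppose $X=\bigoplus_{i=1}^{n}X_i$ and $Y=\bigoplus_{j=1}^{m}Y_j$ are decompositions into indecomposables in $\mathcal{A}$ with $1_{X_i}\notin\mathcal{I}(X_i,X_i)$ and $1_{Y_j}\notin\mathcal{I}(Y_j,Y_j)$ for all $i,j$. Then $f+\mathcal{I}(X,Y)\colon X\to Y$ is irreducible and left almost split in $\mathcal{A}/\mathcal{I}$ if and only if there exists $g\colon X\to Y'$ in $\mathcal{A}$ with $1_{Y'}\in\mathcal{I}(Y',Y')$ such that $\begin{pmatrix}f\\ g\end{pmatrix}\colon X\to Y\oplus Y'$ is minimal left almost split in $\mathcal{A}$.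
   Context: A $k$-category is an additive category whose Hom-sets are $k$-modules and whose composition is $k$-bilinear. An additive category is Krull-Schmidt if every object is a finite direct sum of objects with local endomorphism rings. Ideals are two-sided ideals of morphisms; $\mathcal{A}/\mathcal{I}$ has the same objects as $\mathcal{A}$ and Hom-modules $\operatorname{Hom}_{\mathcal{A}}(X,Y)/\mathcal{I}(X,Y)$. A section is a morphism with a left inverse and a retraction is a morphism with a right inverse. A morphism $f\colon X\to Y$ is left almost split if it is not a section and every non-section $u\colon X\to U$ factors as $u=\hat u f$ for some $\hat u\colon Y\to U$; it is left minimal if $gf=f$ with $g\colon Y\to Y$ implies $g$ is an automorphism; it is minimal left almost split if both hold. Minimal right almost split is defined dually. A morphism $f$ is irreducible if it is neither a section nor a retraction, and whenever $f=hg$, either $h$ is a retraction or $g$ is a section. A weak kernel of $f\colon X\to Y$ is a morphism $w\colon W\to X$ with $fw=0$ such that every $g\colon V\to X$ with $fg=0$ factors (not necessarily uniquely) through $w$; weak cokernels are dual. An Auslander-Reiten sequence is a sequence $X\xrightarrow{f}Y\xrightarrow{g}Z$ such that $f$ is a weak kernel of $g$, $g$ is a weak cokernel of $f$, $f$ is minimal left almost split, and $g$ is minimal right almost split (the middle term is allowed to be zero). An object $X$ is pseudo-injective if there exists a minimal left almost split epimorphism $X\to Y$. A Krull-Schmidt $k$-category is a right Auslander-Reiten category if every indecomposable object $X$ is either pseudo-injective or the first term of an Auslander-Reiten sequence. The radical is $\operatorname{rad}_{\mathcal{A}}(X,Y)=\{f\in\operatorname{Hom}_{\mathcal{A}}(X,Y)\mid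 1_X-gf\text{ is invertible for all }g\colon Y\to X\}$, and $\operatorname{rad}^2_{\mathcal{A}}(X,Y)$ is the $k$-submodule of $\operatorname{Hom}_{\mathcal{A}}(X,Y)$ generated by compositions of two radical morphisms. An ideal $\mathcal{I}$ is admissible if: (1) whenever $X,Y$ are indecomposable with $1_X\notin\mathcal{I}(X,X)$ and $1_Y\notin\mathcal{I}(Y,Y)$, then $\mathcal{I}(X,Y)\subseteq\operatorname{rad}^2_{\mathcal{A}}(X,Y)$; (2) if $f\colon X\to Y$ is minimal left almost split with $1_X\notin\mathcal{I}(X,X)$ and $g\in\mathcal{I}(X,M)$, then $g=hf$ for some $h\in\mathcal{I}(Y,M)$; (3) if $f\colon X\to Y$ is minimal right almost split with $1_Y\notin\mathcal{I}(Y,Y)$ and $g\in\mathcal{I}(M,Y)$, then $g=fh$ for some $h\in\mathcal{I}(M,X)$.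
   Formalization: The decomposition of Y is required to have at least one summand (m ≥ 1, so Y is nonzero); for Y = 0 the equivalence can fail, e.g. f: k → 0 in finite-dimensional vector spaces over a field with I = 0. *)

theory Defs
  imports "HOL-Algebra.Module" "HOL-Algebra.AbelCoset"
begin

text \<open>
  Objects are the elements of \<open>Obj C\<close>, and the morphisms from \<open>X\<close> to \<open>Y\<close> are the
  elements of the carrier of \<open>Hom C X Y\<close>, which is a module in the sense of HOL-Algebra.  (The fields
  \<open>mult\<close> and \<open>one\<close> that a module record inherits from ring records play no role.)
  Hom-sets of different pairs of objects need not be disjoint; therefore composition is indexed by
  objects: \<open>cmp C X Y Z g f\<close> is the composite \<open>gf\<close> of \<open>f : X \<rightarrow> Y\<close> and \<open>g : Y \<rightarrow> Z\<close>.
\<close>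

record ('o, 'm, 'k) kcat =
  Obj :: "'o set"
  Hom :: "'o \<Rightarrow> 'o \<Rightarrow> ('k, 'm) module"
  cmp :: "'o \<Rightarrow> 'o \<Rightarrow> 'o \<Rightarrow> 'm \<Rightarrow> 'm \<Rightarrow> 'm"
  ident :: "'o \<Rightarrow> 'm"

definition arr :: "('o, 'm, 'k) kcat \<Rightarrow> 'o \<Rightarrow> 'o \<Rightarrow> 'm \<Rightarrow> bool" where
  "arr C X Y f \<longleftrightarrow> X \<in> Obj C \<and> Y \<in> Obj C \<and> f \<in> carrier (Hom C X Y)"


section \<open>Additive structure\<close>

definition zero_object :: "('o, 'm, 'k) kcat \<Rightarrow> 'o \<Rightarrow> bool" where
  "zero_object C Z \<longleftrightarrow> Z \<in> Obj C \<and>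
     (\<forall>X\<in>Obj C. (\<exists>!f. arr C X Z f) \<and> (\<exists>!f. arr C Z X f))"

definition biproduct ::
  "('o, 'm, 'k) kcat \<Rightarrow> 'o \<Rightarrow> 'o \<Rightarrow> 'o \<Rightarrow> 'm \<Rightarrow> 'm \<Rightarrow> 'm \<Rightarrow> 'm \<Rightarrow> bool" where
  "biproduct C A B S i\<^sub>1 i\<^sub>2 p\<^sub>1 p\<^sub>2 \<longleftrightarrow>
     arr C A S i\<^sub>1 \<and> arr C B S i\<^sub>2 \<and> arr C S A p\<^sub>1 \<and> arr C S B p\<^sub>2 \<and>
     cmp C A S A p\<^sub>1 i\<^sub>1 = ident C A \<and> cmp C B S B p\<^sub>2 i\<^sub>2 = ident C B \<and>
     cmp C B S A p\<^sub>1 i\<^sub>2 = \<zero>\<^bsub>Hom C B A\<^esub> \<and> cmp C A S B p\<^sub>2 i\<^sub>1 = \<zero>\<^bsub>Hom C A B\<^esub> \<and>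
     cmp C S A S i\<^sub>1 p\<^sub>1 \<oplus>\<^bsub>Hom C S S\<^esub> cmp C S B S i\<^sub>2 p\<^sub>2 = ident C S"

text \<open>\<open>S\<close> is a direct sum of the family \<open>(X\<^sub>i)\<close>, \<open>i = 1, \<dots>, n\<close>; for \<open>n = 0\<close> this
  says that \<open>S\<close> is a zero object.\<close>

definition direct_sum :: "('o, 'm, 'k) kcat \<Rightarrow> 'o \<Rightarrow> nat \<Rightarrow> (nat \<Rightarrow> 'o) \<Rightarrow> bool" where
  "direct_sum C S n X \<longleftrightarrow> S \<in> Obj C \<and> (\<exists>\<iota> \<pi>.
     (\<forall>i\<in>{1..n}. arr C (X i) S (\<iota> i) \<and> arr C S (X i) (\<pi> i)) \<and>
     (\<forall>i\<in>{1..n}. \<forall>j\<in>{1..n}. cmp C (X i) S (X j) (\<pi> j) (\<iota> i) =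
        (if i = j then ident C (X i) else \<zero>\<^bsub>Hom C (X i) (X j)\<^esub>)) \<and>
     (\<Oplus>\<^bsub>Hom C S S\<^esub>i\<in>{1..n}. cmp C S (X i) S (\<iota> i) (\<pi> i)) = ident C S)"

locale k_category = cring R for R :: "('k, 'r) ring_scheme" (structure) +
  fixes C :: "('o, 'm, 'k) kcat"
  assumes Hom_module: "\<lbrakk>X \<in> Obj C; Y \<in> Obj C\<rbrakk> \<Longrightarrow> module R (Hom C X Y)"
    and ident_arr: "X \<in> Obj C \<Longrightarrow> arr C X X (ident C X)"
    and cmp_arr: "\<lbrakk>arr C X Y f; arr C Y Z g\<rbrakk> \<Longrightarrow> arr C X Z (cmp C X Y Z g f)"
    and cmp_ident_left: "arr C X Y f \<Longrightarrow> cmp C X Y Y (ident C Y) f = f"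
    and cmp_ident_right: "arr C X Y f \<Longrightarrow> cmp C X X Y f (ident C X) = f"
    and cmp_assoc: "\<lbrakk>arr C W X f; arr C X Y g; arr C Y Z h\<rbrakk> \<Longrightarrow>
      cmp C W Y Z h (cmp C W X Y g f) = cmp C W X Z (cmp C X Y Z h g) f"
    and cmp_add_left: "\<lbrakk>arr C X Y f; arr C Y Z g; arr C Y Z g'\<rbrakk> \<Longrightarrow>
      cmp C X Y Z (g \<oplus>\<^bsub>Hom C Y Z\<^esub> g') f =
        cmp C X Y Z g f \<oplus>\<^bsub>Hom C X Z\<^esub> cmp C X Y Z g' f"
    and cmp_add_right: "\<lbrakk>arr C X Y f; arr C X Y f'; arr C Y Z g\<rbrakk> \<Longrightarrow>
      cmp C X Y Z g (f \<oplus>\<^bsub>Hom C X Y\<^esub> f') =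
        cmp C X Y Z g f \<oplus>\<^bsub>Hom C X Z\<^esub> cmp C X Y Z g f'"
    and cmp_smult_left: "\<lbrakk>a \<in> carrier R; arr C X Y f; arr C Y Z g\<rbrakk> \<Longrightarrow>
      cmp C X Y Z (a \<odot>\<^bsub>Hom C Y Z\<^esub> g) f = a \<odot>\<^bsub>Hom C X Z\<^esub> cmp C X Y Z g f"
    and cmp_smult_right: "\<lbrakk>a \<in> carrier R; arr C X Y f; arr C Y Z g\<rbrakk> \<Longrightarrow>
      cmp C X Y Z g (a \<odot>\<^bsub>Hom C X Y\<^esub> f) = a \<odot>\<^bsub>Hom C X Z\<^esub> cmp C X Y Z g f"
    and has_zero_object: "\<exists>Z. zero_object C Z"
    and has_biproducts: "\<lbrakk>A \<in> Obj C; B \<in> Obj C\<rbrakk> \<Longrightarrow>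
      \<exists>S i\<^sub>1 i\<^sub>2 p\<^sub>1 p\<^sub>2. biproduct C A B S i\<^sub>1 i\<^sub>2 p\<^sub>1 p\<^sub>2"

definition indecomposable :: "('o, 'm, 'k) kcat \<Rightarrow> 'o \<Rightarrow> bool" where
  "indecomposable C X \<longleftrightarrow> X \<in> Obj C \<and> \<not> zero_object C X \<and>
     (\<forall>A B i\<^sub>1 i\<^sub>2 p\<^sub>1 p\<^sub>2. biproduct C A B X i\<^sub>1 i\<^sub>2 p\<^sub>1 p\<^sub>2 \<longrightarrow>
        zero_object C A \<or> zero_object C B)"

definition End_ring :: "('o, 'm, 'k) kcat \<Rightarrow> 'o \<Rightarrow> 'm ring" where
  "End_ring C X = \<lparr>carrier = carrier (Hom C X X), mult = cmp C X X X, one = ident C X,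
     zero = \<zero>\<^bsub>Hom C X X\<^esub>, add = add (Hom C X X)\<rparr>"

text \<open>Local rings need not be commutative: nonzero, and the sum of two nonunits is a nonunit.\<close>

definition local_ring :: "('a, 'b) ring_scheme \<Rightarrow> bool" where
  "local_ring E \<longleftrightarrow> ring E \<and> \<one>\<^bsub>E\<^esub> \<noteq> \<zero>\<^bsub>E\<^esub> \<and>
     (\<forall>a\<in>carrier E - Units E. \<forall>b\<in>carrier E - Units E. a \<oplus>\<^bsub>E\<^esub> b \<notin> Units E)"

locale krull_schmidt_category = k_category +
  assumes krull_schmidt: "S \<in> Obj C \<Longrightarrow>
    \<exists>n X. direct_sum C S n X \<and> (\<forall>i\<in>{1..n}. local_ring (End_ring C (X i)))"


section \<open>Classes of morphisms\<close>

definition is_section :: "('o, 'm, 'k) kcat \<Rightarrow> 'o \<Rightarrow> 'o \<Rightarrow> 'm \<Rightarrow> bool" where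
  "is_section C X Y f \<longleftrightarrow> arr C X Y f \<and> (\<exists>g. arr C Y X g \<and> cmp C X Y X g f = ident C X)"

definition is_retraction :: "('o, 'm, 'k) kcat \<Rightarrow> 'o \<Rightarrow> 'o \<Rightarrow> 'm \<Rightarrow> bool" where
  "is_retraction C X Y f \<longleftrightarrow> arr C X Y f \<and> (\<exists>g. arr C Y X g \<and> cmp C Y X Y f g = ident C Y)"

definition epi :: "('o, 'm, 'k) kcat \<Rightarrow> 'o \<Rightarrow> 'o \<Rightarrow> 'm \<Rightarrow> bool" where
  "epi C X Y f \<longleftrightarrow> arr C X Y f \<and>
     (\<forall>Z g h. arr C Y Z g \<longrightarrow> arr C Y Z h \<longrightarrow> cmp C X Y Z g f = cmp C X Y Z h f \<longrightarrow> g = h)"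

definition left_almost_split :: "('o, 'm, 'k) kcat \<Rightarrow> 'o \<Rightarrow> 'o \<Rightarrow> 'm \<Rightarrow> bool" where
  "left_almost_split C X Y f \<longleftrightarrow> arr C X Y f \<and> \<not> is_section C X Y f \<and>
     (\<forall>U u. arr C X U u \<longrightarrow> \<not> is_section C X U u \<longrightarrow>
        (\<exists>v. arr C Y U v \<and> u = cmp C X Y U v f))"

definition right_almost_split :: "('o, 'm, 'k) kcat \<Rightarrow> 'o \<Rightarrow> 'o \<Rightarrow> 'm \<Rightarrow> bool" where
  "right_almost_split C X Y f \<longleftrightarrow> arr C X Y f \<and> \<not> is_retraction C X Y f \<and>
     (\<forall>U u. arr C U Y u \<longrightarrow> \<not> is_retraction C U Y u \<longrightarrow>
        (\<exists>v. arr C U X v \<and> u = cmp C U X Y f v))"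

definition left_minimal :: "('o, 'm, 'k) kcat \<Rightarrow> 'o \<Rightarrow> 'o \<Rightarrow> 'm \<Rightarrow> bool" where
  "left_minimal C X Y f \<longleftrightarrow> arr C X Y f \<and>
     (\<forall>g. arr C Y Y g \<longrightarrow> cmp C X Y Y g f = f \<longrightarrow> g \<in> Units (End_ring C Y))"

definition right_minimal :: "('o, 'm, 'k) kcat \<Rightarrow> 'o \<Rightarrow> 'o \<Rightarrow> 'm \<Rightarrow> bool" where
  "right_minimal C X Y f \<longleftrightarrow> arr C X Y f \<and>
     (\<forall>g. arr C X X g \<longrightarrow> cmp C X X Y f g = f \<longrightarrow> g \<in> Units (End_ring C X))"

definition minimal_left_almost_split :: "('o, 'm, 'k) kcat \<Rightarrow> 'o \<Rightarrow> 'o \<Rightarrow> 'm \<Rightarrow> bool" where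
  "minimal_left_almost_split C X Y f \<longleftrightarrow> left_minimal C X Y f \<and> left_almost_split C X Y f"

definition minimal_right_almost_split :: "('o, 'm, 'k) kcat \<Rightarrow> 'o \<Rightarrow> 'o \<Rightarrow> 'm \<Rightarrow> bool" where
  "minimal_right_almost_split C X Y f \<longleftrightarrow> right_minimal C X Y f \<and> right_almost_split C X Y f"

definition irreducible_morphism :: "('o, 'm, 'k) kcat \<Rightarrow> 'o \<Rightarrow> 'o \<Rightarrow> 'm \<Rightarrow> bool" where
  "irreducible_morphism C X Y f \<longleftrightarrow> arr C X Y f \<and>
     \<not> is_section C X Y f \<and> \<not> is_retraction C X Y f \<and>
     (\<forall>Z g h. arr C X Z g \<longrightarrow> arr C Z Y h \<longrightarrow> f = cmp C X Z Y h g \<longrightarrow>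
        is_retraction C Z Y h \<or> is_section C X Z g)"


section \<open>Auslander-Reiten categories\<close>

definition weak_kernel :: "('o, 'm, 'k) kcat \<Rightarrow> 'o \<Rightarrow> 'o \<Rightarrow> 'o \<Rightarrow> 'm \<Rightarrow> 'm \<Rightarrow> bool" where
  \<comment> \<open>\<open>w : W \<rightarrow> X\<close> is a weak kernel of \<open>f : X \<rightarrow> Y\<close>\<close>
  "weak_kernel C W X Y w f \<longleftrightarrow> arr C W X w \<and> arr C X Y f \<and>
     cmp C W X Y f w = \<zero>\<^bsub>Hom C W Y\<^esub> \<and>
     (\<forall>V g. arr C V X g \<longrightarrow> cmp C V X Y f g = \<zero>\<^bsub>Hom C V Y\<^esub> \<longrightarrow>
        (\<exists>h. arr C V W h \<and> g = cmp C V W X w h))"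

definition weak_cokernel :: "('o, 'm, 'k) kcat \<Rightarrow> 'o \<Rightarrow> 'o \<Rightarrow> 'o \<Rightarrow> 'm \<Rightarrow> 'm \<Rightarrow> bool" where
  \<comment> \<open>\<open>w : Y \<rightarrow> W\<close> is a weak cokernel of \<open>f : X \<rightarrow> Y\<close>\<close>
  "weak_cokernel C X Y W f w \<longleftrightarrow> arr C X Y f \<and> arr C Y W w \<and>
     cmp C X Y W w f = \<zero>\<^bsub>Hom C X W\<^esub> \<and>
     (\<forall>V g. arr C Y V g \<longrightarrow> cmp C X Y V g f = \<zero>\<^bsub>Hom C X V\<^esub> \<longrightarrow>
        (\<exists>h. arr C W V h \<and> g = cmp C Y W V h w))"

definition AR_sequence :: "('o, 'm, 'k) kcat \<Rightarrow> 'o \<Rightarrow> 'o \<Rightarrow> 'o \<Rightarrow> 'm \<Rightarrow> 'm \<Rightarrow> bool" where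
  "AR_sequence C X Y Z f g \<longleftrightarrow>
     weak_kernel C X Y Z f g \<and> weak_cokernel C X Y Z f g \<and>
     minimal_left_almost_split C X Y f \<and> minimal_right_almost_split C Y Z g"

definition pseudo_injective :: "('o, 'm, 'k) kcat \<Rightarrow> 'o \<Rightarrow> bool" where
  "pseudo_injective C X \<longleftrightarrow> (\<exists>Y f. minimal_left_almost_split C X Y f \<and> epi C X Y f)"

locale right_AR_category = krull_schmidt_category +
  assumes right_AR: "indecomposable C X \<Longrightarrow>
    pseudo_injective C X \<or> (\<exists>Y Z f g. AR_sequence C X Y Z f g)"


section \<open>Radical, ideals and quotient categories\<close>

definition rad :: "('o, 'm, 'k) kcat \<Rightarrow> 'o \<Rightarrow> 'o \<Rightarrow> 'm set" where
  "rad C X Y = {f. arr C X Y f \<and>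
     (\<forall>g. arr C Y X g \<longrightarrow>
        ident C X \<ominus>\<^bsub>Hom C X X\<^esub> cmp C X Y X g f \<in> Units (End_ring C X))}"

definition rad2 :: "('k, 'r) ring_scheme \<Rightarrow> ('o, 'm, 'k) kcat \<Rightarrow> 'o \<Rightarrow> 'o \<Rightarrow> 'm set" where
  "rad2 R C X Y = \<Inter>{H. submodule H R (Hom C X Y) \<and>
     {cmp C X Z Y g f | Z g f. Z \<in> Obj C \<and> f \<in> rad C X Z \<and> g \<in> rad C Z Y} \<subseteq> H}"

definition cat_ideal ::
  "('k, 'r) ring_scheme \<Rightarrow> ('o, 'm, 'k) kcat \<Rightarrow> ('o \<Rightarrow> 'o \<Rightarrow> 'm set) \<Rightarrow> bool" where
  "cat_ideal R C I \<longleftrightarrow>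
     (\<forall>X\<in>Obj C. \<forall>Y\<in>Obj C. submodule (I X Y) R (Hom C X Y)) \<and>
     (\<forall>X\<in>Obj C. \<forall>Y\<in>Obj C. \<forall>Z f g. f \<in> I X Y \<longrightarrow> arr C Y Z g \<longrightarrow> cmp C X Y Z g f \<in> I X Z) \<and>
     (\<forall>Y\<in>Obj C. \<forall>Z\<in>Obj C. \<forall>X f g. arr C X Y f \<longrightarrow> g \<in> I Y Z \<longrightarrow> cmp C X Y Z g f \<in> I X Z)"

definition admissible_ideal ::
  "('k, 'r) ring_scheme \<Rightarrow> ('o, 'm, 'k) kcat \<Rightarrow> ('o \<Rightarrow> 'o \<Rightarrow> 'm set) \<Rightarrow> bool" where
  "admissible_ideal R C I \<longleftrightarrow> cat_ideal R C I \<and>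
     (\<forall>X Y. indecomposable C X \<longrightarrow> indecomposable C Y \<longrightarrow>
        ident C X \<notin> I X X \<longrightarrow> ident C Y \<notin> I Y Y \<longrightarrow> I X Y \<subseteq> rad2 R C X Y) \<and>
     (\<forall>X Y f M g. minimal_left_almost_split C X Y f \<longrightarrow> ident C X \<notin> I X X \<longrightarrow>
        M \<in> Obj C \<longrightarrow> g \<in> I X M \<longrightarrow> (\<exists>h \<in> I Y M. g = cmp C X Y M h f)) \<and>
     (\<forall>X Y f M g. minimal_right_almost_split C X Y f \<longrightarrow> ident C Y \<notin> I Y Y \<longrightarrow>
        M \<in> Obj C \<longrightarrow> g \<in> I M Y \<longrightarrow> (\<exists>h \<in> I M X. g = cmp C M X Y f h))"

definition coset ::
  "('o, 'm, 'k) kcat \<Rightarrow> ('o \<Rightarrow> 'o \<Rightarrow> 'm set) \<Rightarrow> 'o \<Rightarrow> 'o \<Rightarrow> 'm \<Rightarrow> 'm set" where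
  "coset C I X Y f = I X Y +>\<^bsub>Hom C X Y\<^esub> f"

definition quot_module :: "('k, 'm) module \<Rightarrow> 'm set \<Rightarrow> ('k, 'm set) module" where
  "quot_module M N = \<lparr>carrier = a_rcosets\<^bsub>M\<^esub> N, mult = undefined, one = undefined,
     zero = N, add = set_add M, smult = (\<lambda>a F. \<Union>x\<in>F. N +>\<^bsub>M\<^esub> (a \<odot>\<^bsub>M\<^esub> x))\<rparr>"

text \<open>The unions below (and in the scalar multiplication above) are unions of equal cosets:
  they express the operation on representatives without choosing any.\<close>

definition quot_cat ::
  "('o, 'm, 'k) kcat \<Rightarrow> ('o \<Rightarrow> 'o \<Rightarrow> 'm set) \<Rightarrow> ('o, 'm set, 'k) kcat" where
  "quot_cat C I = \<lparr>Obj = Obj C,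
     Hom = (\<lambda>X Y. quot_module (Hom C X Y) (I X Y)),
     cmp = (\<lambda>X Y Z G F. \<Union>g\<in>G. \<Union>f\<in>F. coset C I X Z (cmp C X Y Z g f)),
     ident = (\<lambda>X. coset C I X X (ident C X))\<rparr>"

end

theory Submission
  imports Defs
begin

text \<open>Write \<open>\<A>\<close> for the category and bars for classes modulo \<open>\<I>\<close>.  The link between \<open>\<A>\<close> and
  \<open>\<A>/\<I>\<close> is that \<open>\<I>\<close> lies in the radical between direct sums of indecomposables outside \<open>\<I>\<close>
  (\<open>ideal_subset_rad\<close>): a morphism \<open>gf + z = 1\<close> with \<open>z \<in> \<I>\<close> makes \<open>gf\<close> invertible, so that sections
  out of \<open>X\<close> and retractions onto \<open>Y\<close> in \<open>\<A>/\<I>\<close> are sections and retractions in \<open>\<A>\<close>.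

  Left minimality enters through \<open>left_minimal_cancel\<close>: if \<open>h\<close> is left minimal and \<open>ah = bh\<close>, then \<open>a\<close>
  and \<open>b\<close> differ by a radical morphism.  Combined with the factorization of \<open>\<I>(X,-)\<close> through \<open>h\<close> inside
  \<open>\<I>\<close>, it turns an equation \<open>ah = bh + z\<close> with \<open>z \<in> \<I>\<close> into \<open>a = b + w + t\<close> with \<open>w \<in> \<I>\<close> and \<open>t\<close>
  radical.

  Suppose that \<open>h = (f, g) : X \<rightarrow> Y \<oplus> Y'\<close> is minimal left almost split and \<open>1\<^sub>Y\<^sub>' \<in> \<I>\<close>.  Non-sections
  factor through \<open>h\<close>, hence through \<open>f\<close> modulo \<open>\<I>\<close>, because the part through \<open>Y'\<close> vanishes.  If
  \<open>f = ba + z\<close> and the class of \<open>a\<close> is not a section, then \<open>a = vh\<close>, and cancelling \<open>h\<close> from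
  \<open>p\<^sub>1h = bvh + z\<close> gives \<open>p\<^sub>1 = bv + w + t\<close>; restricted to \<open>Y\<close>, this says that \<open>b\<close> is a retraction up to
  a radical morphism modulo \<open>\<I>\<close>, hence a retraction in \<open>\<A>/\<I>\<close>
  (\<open>irreducible_left_almost_split_quot\<close>).

  Conversely, if the class of \<open>f\<close> is irreducible and left almost split, then \<open>X\<close> is indecomposable
  (\<open>indecomposable_if_left_almost_split_quot\<close>), and the Auslander-Reiten hypothesis provides a minimal
  left almost split \<open>h : X \<rightarrow> S\<close>.  Write \<open>f = vh\<close>.  Irreducibility makes \<open>v\<close> a retraction in \<open>\<A>/\<I>\<close>, hence
  in \<open>\<A>\<close>.  Idempotents split in \<open>\<A>\<close> (\<open>idempotent_splits\<close>), so \<open>S = Y \<oplus> Y'\<close> with first projection \<open>v\<close>,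
  and \<open>h = (f, g)\<close>.  Since \<open>h\<close> factors through \<open>f\<close> modulo \<open>\<I>\<close>, say by \<open>u\<close>, cancelling \<open>h\<close> from
  \<open>h = uvh + z\<close> gives \<open>1\<^sub>S = uv + w + t\<close>.  On \<open>Y'\<close> the term \<open>uv\<close> vanishes, so the component of
  \<open>w \<in> \<I>\<close> there is invertible and \<open>1\<^sub>Y\<^sub>' \<in> \<I>\<close> (\<open>extend_to_minimal_left_almost_split\<close>).\<close>

section \<open>Morphisms and objects of a linear category\<close>

context k_category
begin

lemma Hom_abelian_group: "\<lbrakk>X \<in> Obj C; Y \<in> Obj C\<rbrakk> \<Longrightarrow> abelian_group (Hom C X Y)"
  using Hom_module by (simp add: module_def)

lemma arr_objs: "arr C X Y f \<Longrightarrow> X \<in> Obj C \<and> Y \<in> Obj C"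
  by (simp add: arr_def)

lemma zero_arr [simp]: "\<lbrakk>X \<in> Obj C; Y \<in> Obj C\<rbrakk> \<Longrightarrow> arr C X Y \<zero>\<^bsub>Hom C X Y\<^esub>"
  using Hom_abelian_group by (simp add: arr_def abelian_group.axioms abelian_monoid.zero_closed)

lemma add_arr [simp]: "\<lbrakk>arr C X Y f; arr C X Y g\<rbrakk> \<Longrightarrow> arr C X Y (f \<oplus>\<^bsub>Hom C X Y\<^esub> g)"
  using Hom_abelian_group by (simp add: arr_def abelian_group.axioms abelian_monoid.a_closed)

lemma neg_arr [simp]: "arr C X Y f \<Longrightarrow> arr C X Y (\<ominus>\<^bsub>Hom C X Y\<^esub> f)"
  using Hom_abelian_group by (simp add: arr_def abelian_group.a_inv_closed)

lemma minus_arr [simp]: "\<lbrakk>arr C X Y f; arr C X Y g\<rbrakk> \<Longrightarrow> arr C X Y (f \<ominus>\<^bsub>Hom C X Y\<^esub> g)"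
  by (simp add: a_minus_def)

lemma smult_arr: "\<lbrakk>a \<in> carrier R; arr C X Y f\<rbrakk> \<Longrightarrow> arr C X Y (a \<odot>\<^bsub>Hom C X Y\<^esub> f)"
  using module.smult_closed[OF Hom_module] by (auto simp: arr_def)

text \<open>The only idempotent of an abelian group is zero; this shows that composites with zero morphisms
  vanish.\<close>

lemma idempotent_zero:
  "\<lbrakk>arr C X Y f; f \<oplus>\<^bsub>Hom C X Y\<^esub> f = f\<rbrakk> \<Longrightarrow> f = \<zero>\<^bsub>Hom C X Y\<^esub>"
  using Hom_abelian_group[of X Y]
  by (metis abelian_group.l_neg abelian_group.r_neg1 arr_def)

lemma add_zero [simp]:
  assumes "arr C X Y f"
  shows "f \<oplus>\<^bsub>Hom C X Y\<^esub> \<zero>\<^bsub>Hom C X Y\<^esub> = f" and "\<zero>\<^bsub>Hom C X Y\<^esub> \<oplus>\<^bsub>Hom C X Y\<^esub> f = f"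
    and "f \<ominus>\<^bsub>Hom C X Y\<^esub> \<zero>\<^bsub>Hom C X Y\<^esub> = f" and "f \<ominus>\<^bsub>Hom C X Y\<^esub> f = \<zero>\<^bsub>Hom C X Y\<^esub>"
proof -
  interpret H: abelian_group "Hom C X Y" using assms Hom_abelian_group by (simp add: arr_def)
  show "f \<oplus>\<^bsub>Hom C X Y\<^esub> \<zero>\<^bsub>Hom C X Y\<^esub> = f" "\<zero>\<^bsub>Hom C X Y\<^esub> \<oplus>\<^bsub>Hom C X Y\<^esub> f = f"
    "f \<ominus>\<^bsub>Hom C X Y\<^esub> \<zero>\<^bsub>Hom C X Y\<^esub> = f" "f \<ominus>\<^bsub>Hom C X Y\<^esub> f = \<zero>\<^bsub>Hom C X Y\<^esub>"
    using assms by (auto simp: arr_def H.minus_eq H.r_neg)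
qed

lemma minus_add_cancel [simp]:
  assumes "arr C X Y f" "arr C X Y g"
  shows "(f \<ominus>\<^bsub>Hom C X Y\<^esub> g) \<oplus>\<^bsub>Hom C X Y\<^esub> g = f" and "g \<oplus>\<^bsub>Hom C X Y\<^esub> (f \<ominus>\<^bsub>Hom C X Y\<^esub> g) = f"
    and "(f \<oplus>\<^bsub>Hom C X Y\<^esub> g) \<ominus>\<^bsub>Hom C X Y\<^esub> g = f"
proof -
  interpret H: abelian_group "Hom C X Y" using assms Hom_abelian_group by (simp add: arr_def)
  have [simp]: "f \<in> carrier (Hom C X Y)" "g \<in> carrier (Hom C X Y)" using assms by (auto simp: arr_def)
  show "(f \<ominus>\<^bsub>Hom C X Y\<^esub> g) \<oplus>\<^bsub>Hom C X Y\<^esub> g = f"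
    by (simp add: H.minus_eq H.a_assoc H.l_neg)
  then show "g \<oplus>\<^bsub>Hom C X Y\<^esub> (f \<ominus>\<^bsub>Hom C X Y\<^esub> g) = f"
    by (simp add: H.a_comm)
  show "(f \<oplus>\<^bsub>Hom C X Y\<^esub> g) \<ominus>\<^bsub>Hom C X Y\<^esub> g = f"
    by (simp add: H.minus_eq H.a_assoc H.r_neg)
qed

lemma cmp_zero_left [simp]:
  assumes "arr C X Y f" "Z \<in> Obj C"
  shows "cmp C X Y Z \<zero>\<^bsub>Hom C Y Z\<^esub> f = \<zero>\<^bsub>Hom C X Z\<^esub>"
proof (rule idempotent_zero)
  have Y: "Y \<in> Obj C" using assms by (simp add: arr_def)
  show "arr C X Z (cmp C X Y Z \<zero>\<^bsub>Hom C Y Z\<^esub> f)"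
    using assms Y by (intro cmp_arr) auto
  show "cmp C X Y Z \<zero>\<^bsub>Hom C Y Z\<^esub> f \<oplus>\<^bsub>Hom C X Z\<^esub> cmp C X Y Z \<zero>\<^bsub>Hom C Y Z\<^esub> f =
    cmp C X Y Z \<zero>\<^bsub>Hom C Y Z\<^esub> f"
    using assms Y by (simp add: cmp_add_left[symmetric])
qed

lemma cmp_zero_right [simp]:
  assumes "arr C Y Z g" "X \<in> Obj C"
  shows "cmp C X Y Z g \<zero>\<^bsub>Hom C X Y\<^esub> = \<zero>\<^bsub>Hom C X Z\<^esub>"
proof (rule idempotent_zero)
  have Y: "Y \<in> Obj C" using assms by (simp add: arr_def)
  show "arr C X Z (cmp C X Y Z g \<zero>\<^bsub>Hom C X Y\<^esub>)"
    using assms Y by (intro cmp_arr) auto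
  show "cmp C X Y Z g \<zero>\<^bsub>Hom C X Y\<^esub> \<oplus>\<^bsub>Hom C X Z\<^esub> cmp C X Y Z g \<zero>\<^bsub>Hom C X Y\<^esub> =
    cmp C X Y Z g \<zero>\<^bsub>Hom C X Y\<^esub>"
    using assms Y by (simp add: cmp_add_right[symmetric])
qed

lemma cmp_minus_left:
  assumes "arr C X Y f" "arr C Y Z g" "arr C Y Z g'"
  shows "cmp C X Y Z (g \<ominus>\<^bsub>Hom C Y Z\<^esub> g') f = cmp C X Y Z g f \<ominus>\<^bsub>Hom C X Z\<^esub> cmp C X Y Z g' f"
proof -
  have "cmp C X Y Z (g \<ominus>\<^bsub>Hom C Y Z\<^esub> g') f =
      (cmp C X Y Z (g \<ominus>\<^bsub>Hom C Y Z\<^esub> g') f \<oplus>\<^bsub>Hom C X Z\<^esub> cmp C X Y Z g' f) \<ominus>\<^bsub>Hom C X Z\<^esub> cmp C X Y Z g' f"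
    by (rule minus_add_cancel(3)[symmetric]) (use assms in \<open>auto intro: cmp_arr\<close>)
  also have "cmp C X Y Z (g \<ominus>\<^bsub>Hom C Y Z\<^esub> g') f \<oplus>\<^bsub>Hom C X Z\<^esub> cmp C X Y Z g' f = cmp C X Y Z g f"
    using assms by (simp add: cmp_add_left[symmetric])
  finally show ?thesis .
qed

lemma cmp_minus_right:
  assumes "arr C X Y f" "arr C X Y f'" "arr C Y Z g"
  shows "cmp C X Y Z g (f \<ominus>\<^bsub>Hom C X Y\<^esub> f') = cmp C X Y Z g f \<ominus>\<^bsub>Hom C X Z\<^esub> cmp C X Y Z g f'"
proof -
  have "cmp C X Y Z g (f \<ominus>\<^bsub>Hom C X Y\<^esub> f') =
      (cmp C X Y Z g (f \<ominus>\<^bsub>Hom C X Y\<^esub> f') \<oplus>\<^bsub>Hom C X Z\<^esub> cmp C X Y Z g f') \<ominus>\<^bsub>Hom C X Z\<^esub> cmp C X Y Z g f'"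
    by (rule minus_add_cancel(3)[symmetric]) (use assms in \<open>auto intro: cmp_arr\<close>)
  also have "cmp C X Y Z g (f \<ominus>\<^bsub>Hom C X Y\<^esub> f') \<oplus>\<^bsub>Hom C X Z\<^esub> cmp C X Y Z g f' = cmp C X Y Z g f"
    using assms by (simp add: cmp_add_right[symmetric])
  finally show ?thesis .
qed

lemmas cmp_distribs = cmp_add_left cmp_add_right cmp_minus_left cmp_minus_right
lemmas arr_intros = cmp_arr add_arr minus_arr ident_arr zero_arr neg_arr

lemma zero_object_iff_ident_eq_zero:
  assumes "X \<in> Obj C"
  shows "zero_object C X \<longleftrightarrow> ident C X = \<zero>\<^bsub>Hom C X X\<^esub>"
proof
  assume "zero_object C X"
  then show "ident C X = \<zero>\<^bsub>Hom C X X\<^esub>"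
    using assms ident_arr[of X] zero_arr[of X X] unfolding zero_object_def by blast
next
  assume 0: "ident C X = \<zero>\<^bsub>Hom C X X\<^esub>"
  have "f = \<zero>\<^bsub>Hom C A X\<^esub>" if "arr C A X f" for A f
    using cmp_ident_left[OF that] cmp_zero_left[OF that assms] 0 by simp
  moreover have "f = \<zero>\<^bsub>Hom C X A\<^esub>" if "arr C X A f" for A f
    using cmp_ident_right[OF that] cmp_zero_right[OF that assms] 0 by simp
  ultimately show "zero_object C X"
    using assms zero_arr unfolding zero_object_def by (metis (no_types))
qed

lemma indecomposable_iso:
  assumes kk: "arr C L X \<iota>" "arr C X L \<pi>" and pi: "cmp C L X L \<pi> \<iota> = ident C L"
    and ip: "cmp C X L X \<iota> \<pi> = ident C X" and ind: "indecomposable C L"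
  shows "indecomposable C X"
  unfolding indecomposable_def
proof (intro conjI allI impI)
  have obj: "X \<in> Obj C" "L \<in> Obj C" using kk by (auto simp: arr_def)
  show "X \<in> Obj C" by (rule obj)
  show "\<not> zero_object C X"
  proof
    assume "zero_object C X"
    then have 0: "ident C X = \<zero>\<^bsub>Hom C X X\<^esub>" using zero_object_iff_ident_eq_zero obj by blast
    have "ident C L = cmp C L X L \<pi> (cmp C L X X (ident C X) \<iota>)" using pi kk by (simp add: cmp_ident_left)
    also have "\<dots> = \<zero>\<^bsub>Hom C L L\<^esub>" unfolding 0 using kk obj by simp
    finally show False using ind obj zero_object_iff_ident_eq_zero unfolding indecomposable_def by blast
  qed
  fix A B i j p q assume "biproduct C A B X i j p q"
  then have b: "arr C A X i" "arr C B X j" "arr C X A p" "arr C X B q"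
    "cmp C A X A p i = ident C A" "cmp C B X B q j = ident C B"
    "cmp C B X A p j = \<zero>\<^bsub>Hom C B A\<^esub>" "cmp C A X B q i = \<zero>\<^bsub>Hom C A B\<^esub>"
    "cmp C X A X i p \<oplus>\<^bsub>Hom C X X\<^esub> cmp C X B X j q = ident C X"
    by (auto simp: biproduct_def)
  have mid: "cmp C D L E (cmp C L X E u \<iota>) (cmp C D X L \<pi> v) = cmp C D X E u v"
    if "arr C D X v" "arr C X E u" for D E u v
  proof -
    have "cmp C D L E (cmp C L X E u \<iota>) (cmp C D X L \<pi> v) =
        cmp C D X E u (cmp C D X X (cmp C X L X \<iota> \<pi>) v)"
      using that kk by (simp add: cmp_assoc cmp_arr)
    then show ?thesis using that ip by (simp add: cmp_ident_left)
  qed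
  have "cmp C L X L \<pi> (cmp C L X X (cmp C X A X i p \<oplus>\<^bsub>Hom C X X\<^esub> cmp C X B X j q) \<iota>) = ident C L"
    unfolding b(9) using kk pi by (simp add: cmp_ident_left)
  then have "cmp C L A L (cmp C A X L \<pi> i) (cmp C L X A p \<iota>) \<oplus>\<^bsub>Hom C L L\<^esub>
      cmp C L B L (cmp C B X L \<pi> j) (cmp C L X B q \<iota>) = ident C L"
    using kk b(1-4) by (simp add: cmp_distribs cmp_arr cmp_assoc)
  then have "biproduct C A B L (cmp C A X L \<pi> i) (cmp C B X L \<pi> j)
      (cmp C L X A p \<iota>) (cmp C L X B q \<iota>)"
    unfolding biproduct_def using b kk by (simp add: mid cmp_arr)
  then show "zero_object C A \<or> zero_object C B" using ind unfolding indecomposable_def by blast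
qed

text \<open>Choosing for \<open>P s\<close> a property of a composite with \<open>s\<close> avoids distributing compositions over
  finite sums.\<close>

lemma finsum_induct_arr:
  assumes "finite A" "X \<in> Obj C" "Y \<in> Obj C" "\<And>i. i \<in> A \<Longrightarrow> arr C X Y (t i)"
    and "P \<zero>\<^bsub>Hom C X Y\<^esub>" "\<And>i s. \<lbrakk>i \<in> A; arr C X Y s; P s\<rbrakk> \<Longrightarrow> P (t i \<oplus>\<^bsub>Hom C X Y\<^esub> s)"
  shows "P (\<Oplus>\<^bsub>Hom C X Y\<^esub>i\<in>A. t i)"
proof -
  interpret H: abelian_group "Hom C X Y" using assms Hom_abelian_group by simp
  have "arr C X Y (\<Oplus>\<^bsub>Hom C X Y\<^esub>i\<in>A. t i) \<and> P (\<Oplus>\<^bsub>Hom C X Y\<^esub>i\<in>A. t i)"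
    using assms(1,4,6)
  proof (induction A rule: finite_induct)
    case empty
    show ?case using assms by simp
  next
    case (insert i A)
    have "(\<Oplus>\<^bsub>Hom C X Y\<^esub>j\<in>insert i A. t j) = t i \<oplus>\<^bsub>Hom C X Y\<^esub> (\<Oplus>\<^bsub>Hom C X Y\<^esub>j\<in>A. t j)"
      using insert.hyps insert.prems(1) by (intro H.finsum_insert) (auto simp: arr_def)
    then show ?case using insert by simp
  qed
  then show ?thesis by simp
qed

lemma End_ring_simps [simp]:
  "carrier (End_ring C X) = carrier (Hom C X X)" "mult (End_ring C X) = cmp C X X X"
  "one (End_ring C X) = ident C X" "zero (End_ring C X) = \<zero>\<^bsub>Hom C X X\<^esub>"
  "add (End_ring C X) = add (Hom C X X)"
  by (simp_all add: End_ring_def)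

lemma Units_End_iff:
  "X \<in> Obj C \<Longrightarrow> u \<in> Units (End_ring C X) \<longleftrightarrow> arr C X X u \<and>
     (\<exists>w. arr C X X w \<and> cmp C X X X u w = ident C X \<and> cmp C X X X w u = ident C X)"
  by (auto simp: Units_def arr_def)

lemma Units_EndE:
  assumes "u \<in> Units (End_ring C X)" "X \<in> Obj C"
  obtains w where "arr C X X u" "arr C X X w" "cmp C X X X u w = ident C X" "cmp C X X X w u = ident C X"
  using assms Units_End_iff by blast

lemma ring_End_ring:
  assumes "X \<in> Obj C"
  shows "ring (End_ring C X)"
proof -
  interpret H: abelian_group "Hom C X X" using assms Hom_abelian_group by simp
  show ?thesis
  proof (rule ringI)
    show "abelian_group (End_ring C X)"
      using assms H.a_comm_group
      by (intro abelian_groupI) (auto simp: H.a_ac intro: H.l_neg H.a_inv_closed)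
    show "monoid (End_ring C X)"
      using assms ident_arr[of X] cmp_arr[of X X _ X]
      by (intro monoidI) (auto simp: arr_def intro!: cmp_assoc[symmetric] cmp_ident_left cmp_ident_right)
  qed (use assms in \<open>auto simp: arr_def intro!: cmp_add_left cmp_add_right\<close>)
qed

lemma Units_End_cmp:
  assumes "u \<in> Units (End_ring C X)" "v \<in> Units (End_ring C X)" "X \<in> Obj C"
  shows "cmp C X X X u v \<in> Units (End_ring C X)"
proof -
  interpret E: ring "End_ring C X" using assms(3) by (rule ring_End_ring)
  show ?thesis using E.Units_m_closed[OF assms(1,2)] by simp
qed


section \<open>The radical\<close>

text \<open>If \<open>c\<close> inverts \<open>1 - ga\<close>, then \<open>1 + acg\<close> inverts \<open>1 - ag\<close>: with \<open>p = acg\<close> and \<open>q = ag\<close>, both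
  \<open>p - qp\<close> and \<open>p - pq\<close> equal \<open>q\<close>.  The definition of the radical tests composites at the source only;
  this swap makes it closed under composition on the right as well.\<close>

lemma Units_ident_minus_swap:
  assumes g: "arr C X Y g" and a: "arr C Y X a"
    and u: "ident C Y \<ominus>\<^bsub>Hom C Y Y\<^esub> cmp C Y X Y g a \<in> Units (End_ring C Y)"
  shows "ident C X \<ominus>\<^bsub>Hom C X X\<^esub> cmp C X Y X a g \<in> Units (End_ring C X)"
proof -
  have obj: "X \<in> Obj C" "Y \<in> Obj C" using g by (auto simp: arr_def)
  let ?q = "cmp C X Y X a g"
  let ?u = "ident C Y \<ominus>\<^bsub>Hom C Y Y\<^esub> cmp C Y X Y g a"
  obtain c where c: "arr C Y Y c" "cmp C Y Y Y ?u c = ident C Y" "cmp C Y Y Y c ?u = ident C Y"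
    using u obj Units_EndE by blast
  note arrs [simp] = g a c(1) obj ident_arr cmp_arr
  let ?p = "cmp C X Y X a (cmp C X Y Y c g)"
  have "cmp C X Y X a (cmp C X Y Y (cmp C Y Y Y ?u c) g) = ?q"
    by (simp add: c cmp_ident_left)
  then have 1: "?p \<ominus>\<^bsub>Hom C X X\<^esub> cmp C X X X ?q ?p = ?q"
    by (simp add: cmp_distribs cmp_ident_left cmp_assoc[symmetric])
  have "cmp C X Y X a (cmp C X Y Y (cmp C Y Y Y c ?u) g) = ?q"
    by (simp add: c cmp_ident_left)
  then have 2: "?p \<ominus>\<^bsub>Hom C X X\<^esub> cmp C X X X ?p ?q = ?q"
    by (simp add: cmp_distribs cmp_ident_left cmp_ident_right cmp_assoc[symmetric])
  have arr_p [simp]: "arr C X X ?p" and arr_q [simp]: "arr C X X ?q" by simp_all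
  let ?w = "ident C X \<oplus>\<^bsub>Hom C X X\<^esub> ?p"
  have arr_w [simp]: "arr C X X ?w" by simp
  have "cmp C X X X ?q ?w = ?q \<oplus>\<^bsub>Hom C X X\<^esub> cmp C X X X ?q ?p"
    by (simp only: cmp_add_right[of X X _ _ X] cmp_ident_right arr_p arr_q ident_arr obj)
  also have "\<dots> = ?p"
    using minus_add_cancel(1)[of X X ?p "cmp C X X X ?q ?p"] by (simp only: 1 arr_p arr_q cmp_arr)
  finally have l: "cmp C X X X (ident C X \<ominus>\<^bsub>Hom C X X\<^esub> ?q) ?w = ident C X"
    by (simp only: cmp_minus_left[OF arr_w ident_arr arr_q] obj cmp_ident_left arr_w)
       (simp only: minus_add_cancel(3) arr_p obj ident_arr)
  have "cmp C X X X ?w ?q = ?q \<oplus>\<^bsub>Hom C X X\<^esub> cmp C X X X ?p ?q"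
    by (simp only: cmp_add_left[of X X _ X] cmp_ident_left arr_p arr_q ident_arr obj)
  also have "\<dots> = ?p"
    using minus_add_cancel(1)[of X X ?p "cmp C X X X ?p ?q"] by (simp only: 2 arr_p arr_q cmp_arr)
  finally have r: "cmp C X X X ?w (ident C X \<ominus>\<^bsub>Hom C X X\<^esub> ?q) = ident C X"
    by (simp only: cmp_minus_right[OF ident_arr arr_q arr_w] obj cmp_ident_right arr_w)
       (simp only: minus_add_cancel(3) arr_p obj ident_arr)
  show ?thesis
    using l r arr_w by (subst Units_End_iff) (auto intro!: exI[of _ ?w])
qed

lemma neg_eq_zero_minus: "arr C X Y f \<Longrightarrow> \<ominus>\<^bsub>Hom C X Y\<^esub> f = \<zero>\<^bsub>Hom C X Y\<^esub> \<ominus>\<^bsub>Hom C X Y\<^esub> f"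
  by (simp add: arr_objs a_minus_def)

lemma rad_arr: "f \<in> rad C X Y \<Longrightarrow> arr C X Y f"
  by (simp add: rad_def)

lemma radD:
  "\<lbrakk>f \<in> rad C X Y; arr C Y X g\<rbrakk> \<Longrightarrow> ident C X \<ominus>\<^bsub>Hom C X X\<^esub> cmp C X Y X g f \<in> Units (End_ring C X)"
  by (simp add: rad_def)

lemma rad_cmp_left:
  assumes f: "f \<in> rad C X Y" and g: "arr C Y Z g"
  shows "cmp C X Y Z g f \<in> rad C X Z"
  using assms by (auto simp: rad_def cmp_arr cmp_assoc)

lemma rad_cmp_right:
  assumes f: "f \<in> rad C Y Z" and g: "arr C X Y g"
  shows "cmp C X Y Z f g \<in> rad C X Z"
proof -
  note f' = rad_arr[OF f]
  have "ident C X \<ominus>\<^bsub>Hom C X X\<^esub> cmp C X Z X k (cmp C X Y Z f g) \<in> Units (End_ring C X)"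
    if k: "arr C Z X k" for k
  proof -
    have "ident C Y \<ominus>\<^bsub>Hom C Y Y\<^esub> cmp C Y X Y g (cmp C Y Z X k f) \<in> Units (End_ring C Y)"
      using radD[OF f cmp_arr[OF k g]] f' k g by (simp add: cmp_assoc)
    from Units_ident_minus_swap[OF g cmp_arr[OF f' k] this] show ?thesis
      using f' k g by (simp add: cmp_assoc)
  qed
  then show ?thesis using f' g by (simp add: rad_def cmp_arr)
qed

text \<open>With \<open>u = 1 - kf\<close> invertible, \<open>1 - k(f + f') = u(1 - u\<^sup>-\<^sup>1kf')\<close> is a product of units.\<close>

lemma rad_add:
  assumes f: "f \<in> rad C X Y" and f': "f' \<in> rad C X Y"
  shows "f \<oplus>\<^bsub>Hom C X Y\<^esub> f' \<in> rad C X Y"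
proof -
  note arrs = rad_arr[OF f] rad_arr[OF f']
  have obj: "X \<in> Obj C" using arrs by (simp add: arr_def)
  have "ident C X \<ominus>\<^bsub>Hom C X X\<^esub> cmp C X Y X k (f \<oplus>\<^bsub>Hom C X Y\<^esub> f') \<in> Units (End_ring C X)"
    if k: "arr C Y X k" for k
  proof -
    let ?u = "ident C X \<ominus>\<^bsub>Hom C X X\<^esub> cmp C X Y X k f"
    have u: "?u \<in> Units (End_ring C X)" using f k by (rule radD)
    then obtain w where w: "arr C X X w" "cmp C X X X ?u w = ident C X"
      using obj Units_EndE by blast
    have arr_u: "arr C X X ?u" and kf: "arr C X X (cmp C X Y X k f)" and kf': "arr C X X (cmp C X Y X k f')"
      using arrs k obj by (auto intro!: arr_intros)
    let ?v = "ident C X \<ominus>\<^bsub>Hom C X X\<^esub> cmp C X Y X (cmp C Y X X w k) f'"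
    have "?v \<in> Units (End_ring C X)"
      using f' w k by (intro radD cmp_arr)
    then have "cmp C X X X ?u ?v \<in> Units (End_ring C X)"
      using u obj by (intro Units_End_cmp)
    also have "cmp C X X X ?u ?v = ?u \<ominus>\<^bsub>Hom C X X\<^esub> cmp C X X X ?u (cmp C X Y X (cmp C Y X X w k) f')"
      using arr_u w k arrs obj by (subst cmp_minus_right) (auto simp: cmp_ident_right intro: arr_intros)
    also have "cmp C X X X ?u (cmp C X Y X (cmp C Y X X w k) f') =
        cmp C X Y X (cmp C Y X X (cmp C X X X ?u w) k) f'"
      using arr_u w(1) k arrs by (simp only: cmp_assoc cmp_arr)
    also have "\<dots> = cmp C X Y X k f'"
      using w k by (simp add: cmp_ident_left)
    also have "?u \<ominus>\<^bsub>Hom C X X\<^esub> cmp C X Y X k f' =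
        ident C X \<ominus>\<^bsub>Hom C X X\<^esub> (cmp C X Y X k f \<oplus>\<^bsub>Hom C X X\<^esub> cmp C X Y X k f')"
    proof -
      interpret H: abelian_group "Hom C X X" using obj Hom_abelian_group by simp
      show ?thesis
        using kf kf' ident_arr[OF obj] by (simp add: H.minus_eq H.minus_add H.a_assoc arr_def)
    qed
    finally show ?thesis using k arrs by (simp add: cmp_add_right)
  qed
  then show ?thesis using arrs by (simp add: rad_def)
qed

lemma rad_zero:
  assumes "X \<in> Obj C" "Y \<in> Obj C"
  shows "\<zero>\<^bsub>Hom C X Y\<^esub> \<in> rad C X Y"
proof -
  have "ident C X \<in> Units (End_ring C X)"
    using assms ident_arr[of X] by (subst Units_End_iff) (auto simp: cmp_ident_left)
  then show ?thesis using assms by (auto simp: rad_def ident_arr)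
qed

lemma rad_neg:
  assumes f: "f \<in> rad C X Y"
  shows "\<ominus>\<^bsub>Hom C X Y\<^esub> f \<in> rad C X Y"
proof -
  note f' = rad_arr[OF f]
  have obj: "X \<in> Obj C" "Y \<in> Obj C" using f' by (auto simp: arr_def)
  have "cmp C X Y X k (\<ominus>\<^bsub>Hom C X Y\<^esub> f) = cmp C X Y X (\<ominus>\<^bsub>Hom C Y X\<^esub> k) f" if "arr C Y X k" for k
    using that f' obj by (simp add: neg_eq_zero_minus cmp_distribs)
  then show ?thesis using radD[OF f] f' by (simp add: rad_def)
qed

lemma rad_smult:
  assumes f: "f \<in> rad C X Y" and a: "a \<in> carrier R"
  shows "a \<odot>\<^bsub>Hom C X Y\<^esub> f \<in> rad C X Y"
proof -
  note f' = rad_arr[OF f]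
  have "cmp C X Y X k (a \<odot>\<^bsub>Hom C X Y\<^esub> f) = cmp C X Y X (a \<odot>\<^bsub>Hom C Y X\<^esub> k) f" if "arr C Y X k" for k
    using that f' a by (simp add: cmp_smult_left cmp_smult_right)
  then show ?thesis using radD[OF f] f' a by (simp add: rad_def smult_arr)
qed

lemma rad2_subset_rad:
  assumes "X \<in> Obj C" "Y \<in> Obj C"
  shows "rad2 R C X Y \<subseteq> rad C X Y"
proof -
  interpret M: module R "Hom C X Y" using assms by (rule Hom_module)
  have "submodule (rad C X Y) R (Hom C X Y)"
    by (rule M.submoduleI) (use assms rad_arr in \<open>auto simp: arr_def intro: rad_zero rad_neg rad_add rad_smult\<close>)
  moreover have "{cmp C X Z Y g f | Z g f. Z \<in> Obj C \<and> f \<in> rad C X Z \<and> g \<in> rad C Z Y} \<subseteq> rad C X Y"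
    using rad_cmp_left rad_arr by blast
  ultimately show ?thesis unfolding rad2_def by blast
qed

text \<open>The form in which the radical is used throughout: radical errors in an equation for an identity
  can be absorbed into an automorphism.\<close>

lemma Units_End_if_ident_eq_add_rad:
  assumes "ident C X = a \<oplus>\<^bsub>Hom C X X\<^esub> t" "arr C X X a" "t \<in> rad C X X"
  shows "a \<in> Units (End_ring C X)"
proof -
  have t: "arr C X X t" "X \<in> Obj C" using assms rad_arr[of t X X] by (auto simp: arr_def)
  have "a = ident C X \<ominus>\<^bsub>Hom C X X\<^esub> t"
    unfolding assms(1) using assms t by simp
  then have "a = ident C X \<ominus>\<^bsub>Hom C X X\<^esub> cmp C X X X (ident C X) t"
    using t by (simp only: cmp_ident_left)
  then show ?thesis using radD[OF assms(3) ident_arr] t by simp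
qed

text \<open>Together with its dual below, this reduces membership in the radical to the entries of a matrix of
  morphisms between summands: insert \<open>1 = \<Sum> \<iota>\<^sub>j\<pi>\<^sub>j\<close>.\<close>

lemma rad_into_direct_sum:
  assumes S: "direct_sum C Y m Ys" and z: "arr C X Y z"
    and components: "\<And>j p. \<lbrakk>j \<in> {1..m}; arr C Y (Ys j) p\<rbrakk> \<Longrightarrow> cmp C X Y (Ys j) p z \<in> rad C X (Ys j)"
  shows "z \<in> rad C X Y"
proof -
  obtain \<iota> \<pi> where arrs: "\<And>i. i \<in> {1..m} \<Longrightarrow> arr C (Ys i) Y (\<iota> i) \<and> arr C Y (Ys i) (\<pi> i)"
    and sum: "(\<Oplus>\<^bsub>Hom C Y Y\<^esub>i\<in>{1..m}. cmp C Y (Ys i) Y (\<iota> i) (\<pi> i)) = ident C Y"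
    using S unfolding direct_sum_def by blast
  have obj: "X \<in> Obj C" "Y \<in> Obj C" using z by (auto simp: arr_def)
  have "cmp C X Y Y (\<Oplus>\<^bsub>Hom C Y Y\<^esub>i\<in>{1..m}. cmp C Y (Ys i) Y (\<iota> i) (\<pi> i)) z \<in> rad C X Y"
  proof (rule finsum_induct_arr[where P = "\<lambda>s. cmp C X Y Y s z \<in> rad C X Y"])
    fix i s assume i: "i \<in> {1..m}" and s: "arr C Y Y s" "cmp C X Y Y s z \<in> rad C X Y"
    have "cmp C X (Ys i) Y (\<iota> i) (cmp C X Y (Ys i) (\<pi> i) z) \<in> rad C X Y"
      using arrs[OF i] components[OF i] rad_cmp_left by blast
    then show "cmp C X Y Y (cmp C Y (Ys i) Y (\<iota> i) (\<pi> i) \<oplus>\<^bsub>Hom C Y Y\<^esub> s) z \<in> rad C X Y"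
      using arrs[OF i] s z by (simp add: cmp_add_left cmp_assoc cmp_arr rad_add)
  qed (use arrs obj z in \<open>auto intro: cmp_arr rad_zero\<close>)
  then show ?thesis using z unfolding sum by (simp add: cmp_ident_left)
qed

lemma rad_from_direct_sum:
  assumes S: "direct_sum C X n Xs" and z: "arr C X Y z"
    and components: "\<And>i q. \<lbrakk>i \<in> {1..n}; arr C (Xs i) X q\<rbrakk> \<Longrightarrow> cmp C (Xs i) X Y z q \<in> rad C (Xs i) Y"
  shows "z \<in> rad C X Y"
proof -
  obtain \<iota> \<pi> where arrs: "\<And>i. i \<in> {1..n} \<Longrightarrow> arr C (Xs i) X (\<iota> i) \<and> arr C X (Xs i) (\<pi> i)"
    and sum: "(\<Oplus>\<^bsub>Hom C X X\<^esub>i\<in>{1..n}. cmp C X (Xs i) X (\<iota> i) (\<pi> i)) = ident C X"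
    using S unfolding direct_sum_def by blast
  have obj: "X \<in> Obj C" "Y \<in> Obj C" using z by (auto simp: arr_def)
  have "cmp C X X Y z (\<Oplus>\<^bsub>Hom C X X\<^esub>i\<in>{1..n}. cmp C X (Xs i) X (\<iota> i) (\<pi> i)) \<in> rad C X Y"
  proof (rule finsum_induct_arr[where P = "\<lambda>s. cmp C X X Y z s \<in> rad C X Y"])
    fix i s assume i: "i \<in> {1..n}" and s: "arr C X X s" "cmp C X X Y z s \<in> rad C X Y"
    have "cmp C X (Xs i) Y (cmp C (Xs i) X Y z (\<iota> i)) (\<pi> i) \<in> rad C X Y"
      using arrs[OF i] components[OF i] rad_cmp_right by blast
    then show "cmp C X X Y z (cmp C X (Xs i) X (\<iota> i) (\<pi> i) \<oplus>\<^bsub>Hom C X X\<^esub> s) \<in> rad C X Y"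
      using arrs[OF i] s z by (simp add: cmp_add_right cmp_assoc cmp_arr rad_add)
  qed (use arrs obj z in \<open>auto intro: cmp_arr rad_zero\<close>)
  then show ?thesis using z unfolding sum by (simp add: cmp_ident_right)
qed

text \<open>For \<open>t = a - b\<close> and any \<open>k\<close>, the endomorphism \<open>1 - kt\<close> fixes \<open>h\<close>, so minimality makes it
  invertible; this is the definition of \<open>t\<close> being radical.\<close>

lemma left_minimal_cancel:
  assumes min: "left_minimal C X S h" and a: "arr C S Y a" and b: "arr C S Y b"
    and eq: "cmp C X S Y a h = cmp C X S Y b h"
  obtains t where "t \<in> rad C S Y" "a = b \<oplus>\<^bsub>Hom C S Y\<^esub> t"
proof
  let ?t = "a \<ominus>\<^bsub>Hom C S Y\<^esub> b"
  have h: "arr C X S h" using min by (simp add: left_minimal_def)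
  have obj: "X \<in> Obj C" "S \<in> Obj C" "Y \<in> Obj C" using h a by (auto simp: arr_def)
  have t: "arr C S Y ?t" using a b by simp
  have th: "cmp C X S Y ?t h = \<zero>\<^bsub>Hom C X Y\<^esub>"
    using eq a b h by (simp add: cmp_minus_left cmp_arr)
  have "ident C S \<ominus>\<^bsub>Hom C S S\<^esub> cmp C S Y S k ?t \<in> Units (End_ring C S)" if k: "arr C Y S k" for k
  proof -
    have kt: "arr C S S (cmp C S Y S k ?t)" using k t by (rule cmp_arr[rotated])
    have "cmp C X S S (ident C S \<ominus>\<^bsub>Hom C S S\<^esub> cmp C S Y S k ?t) h =
        h \<ominus>\<^bsub>Hom C X S\<^esub> cmp C X S S (cmp C S Y S k ?t) h"
      using h kt obj by (simp add: cmp_minus_left ident_arr cmp_ident_left)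
    also have "cmp C X S S (cmp C S Y S k ?t) h = \<zero>\<^bsub>Hom C X S\<^esub>"
      using h t k th obj by (simp add: cmp_assoc[symmetric])
    finally have "cmp C X S S (ident C S \<ominus>\<^bsub>Hom C S S\<^esub> cmp C S Y S k ?t) h = h"
      using h by simp
    then show ?thesis
      using min kt obj by (simp add: left_minimal_def ident_arr)
  qed
  then show "?t \<in> rad C S Y" using t by (simp add: rad_def)
  show "a = b \<oplus>\<^bsub>Hom C S Y\<^esub> ?t" using a b by simp
qed

end


section \<open>Idempotents split in Krull-Schmidt categories\<close>

text \<open>Endomorphisms of \<open>S\<close> that are sums of \<open>n\<close> endomorphisms factoring through objects with local
  endomorphism rings.  The terms may overlap: this keeps the class stable under composition on both
  sides without increasing \<open>n\<close>, so that \<open>n\<close> can serve as an induction measure.\<close>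

inductive local_sum :: "('o, 'm, 'k) kcat \<Rightarrow> 'o \<Rightarrow> nat \<Rightarrow> 'm \<Rightarrow> bool" for C S where
  zero: "local_sum C S 0 \<zero>\<^bsub>Hom C S S\<^esub>"
| add: "\<lbrakk>local_sum C S n s; arr C L S a; arr C S L b; local_ring (End_ring C L)\<rbrakk> \<Longrightarrow>
    local_sum C S (Suc n) (s \<oplus>\<^bsub>Hom C S S\<^esub> cmp C S L S a b)"

context k_category
begin

lemma local_sum_arr: "\<lbrakk>local_sum C S n s; S \<in> Obj C\<rbrakk> \<Longrightarrow> arr C S S s"
  by (induction rule: local_sum.induct) (auto intro: arr_intros)

lemma local_sum_cmp:
  assumes "local_sum C S n s" "arr C S S x" "arr C S S y"
  shows "local_sum C S n (cmp C S S S x (cmp C S S S s y))"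
  using assms(1)
proof (induction rule: local_sum.induct)
  case zero
  have "S \<in> Obj C" using assms by (simp add: arr_def)
  then show ?case using assms local_sum.zero by simp
next
  case (add n s L a b)
  have s: "arr C S S s" using add.hyps assms local_sum_arr by (auto simp: arr_def)
  have "local_sum C S (Suc n) (cmp C S S S x (cmp C S S S s y) \<oplus>\<^bsub>Hom C S S\<^esub>
      cmp C S L S (cmp C L S S x a) (cmp C S S L b y))"
    using add assms by (intro local_sum.add cmp_arr) auto
  also have "cmp C S L S (cmp C L S S x a) (cmp C S S L b y) = cmp C S S S x (cmp C S S S (cmp C S L S a b) y)"
    using add.hyps assms by (simp add: cmp_assoc cmp_arr)
  also have "cmp C S S S x (cmp C S S S s y) \<oplus>\<^bsub>Hom C S S\<^esub> \<dots> =
      cmp C S S S x (cmp C S S S (s \<oplus>\<^bsub>Hom C S S\<^esub> cmp C S L S a b) y)"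
    using add.hyps s assms by (simp add: cmp_distribs cmp_arr)
  finally show ?case .
qed

lemma local_End_cases:
  assumes L: "local_ring (End_ring C L)" and r: "arr C L L r"
  obtains "r \<in> Units (End_ring C L)" | "ident C L \<ominus>\<^bsub>Hom C L L\<^esub> r \<in> Units (End_ring C L)"
proof -
  have obj: "L \<in> Obj C" using r by (simp add: arr_def)
  have "ident C L \<in> Units (End_ring C L)"
    using obj ident_arr[of L] by (subst Units_End_iff) (auto simp: cmp_ident_left)
  moreover have "r \<oplus>\<^bsub>Hom C L L\<^esub> (ident C L \<ominus>\<^bsub>Hom C L L\<^esub> r) = ident C L"
    using r obj by (simp add: ident_arr)
  moreover have "arr C L L (ident C L \<ominus>\<^bsub>Hom C L L\<^esub> r)" using r obj by (simp add: ident_arr)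
  ultimately have "r \<in> Units (End_ring C L) \<or> ident C L \<ominus>\<^bsub>Hom C L L\<^esub> r \<in> Units (End_ring C L)"
    using L r unfolding local_ring_def arr_def by (metis DiffI End_ring_simps(1,5))
  then show ?thesis using that by blast
qed

text \<open>The splitting object is the biproduct of \<open>L\<close> and \<open>T\<close>.\<close>

lemma add_splittings:
  assumes a: "arr C L S a" "arr C S L b" "cmp C L S L b a = ident C L"
    and c: "arr C T S c" "arr C S T d" "cmp C T S T d c = ident C T"
    and orth: "cmp C T S L b c = \<zero>\<^bsub>Hom C T L\<^esub>" "cmp C L S T d a = \<zero>\<^bsub>Hom C L T\<^esub>"
  shows "\<exists>P \<alpha> \<beta>. arr C P S \<alpha> \<and> arr C S P \<beta> \<and> cmp C P S P \<beta> \<alpha> = ident C P \<and>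
    cmp C S P S \<alpha> \<beta> = cmp C S L S a b \<oplus>\<^bsub>Hom C S S\<^esub> cmp C S T S c d"
proof -
  have obj: "S \<in> Obj C" "L \<in> Obj C" "T \<in> Obj C" using a c by (auto simp: arr_def)
  obtain P i j p q where "biproduct C L T P i j p q" using has_biproducts obj by blast
  then have P: "arr C L P i" "arr C T P j" "arr C P L p" "arr C P T q"
    "cmp C L P L p i = ident C L" "cmp C T P T q j = ident C T"
    "cmp C T P L p j = \<zero>\<^bsub>Hom C T L\<^esub>" "cmp C L P T q i = \<zero>\<^bsub>Hom C L T\<^esub>"
    "cmp C P L P i p \<oplus>\<^bsub>Hom C P P\<^esub> cmp C P T P j q = ident C P"
    by (auto simp: biproduct_def)
  have objP: "P \<in> Obj C" using P by (simp add: arr_def)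
  let ?\<alpha> = "cmp C P L S a p \<oplus>\<^bsub>Hom C P S\<^esub> cmp C P T S c q"
  let ?\<beta> = "cmp C S L P i b \<oplus>\<^bsub>Hom C S P\<^esub> cmp C S T P j d"
  have arrs: "arr C P S ?\<alpha>" "arr C S P ?\<beta>" using a c P by (auto intro: arr_intros)
  have "cmp C P S L b ?\<alpha> = p"
    using a c P orth obj objP by (simp add: cmp_add_right cmp_arr cmp_assoc cmp_ident_left)
  moreover have "cmp C P S T d ?\<alpha> = q"
    using a c P orth obj objP by (simp add: cmp_add_right cmp_arr cmp_assoc cmp_ident_left)
  moreover have "cmp C P S P ?\<beta> ?\<alpha> = cmp C P L P i (cmp C P S L b ?\<alpha>) \<oplus>\<^bsub>Hom C P P\<^esub> cmp C P T P j (cmp C P S T d ?\<alpha>)"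
    using a c P arrs(1) by (subst cmp_add_left) (auto simp: cmp_assoc intro: arr_intros)
  ultimately have "cmp C P S P ?\<beta> ?\<alpha> = ident C P" using P by simp
  moreover have "cmp C S P L p ?\<beta> = b"
    using a c P obj objP by (simp add: cmp_add_right cmp_arr cmp_assoc cmp_ident_left)
  moreover have "cmp C S P T q ?\<beta> = d"
    using a c P obj objP by (simp add: cmp_add_right cmp_arr cmp_assoc cmp_ident_left)
  moreover have "cmp C S P S ?\<alpha> ?\<beta> = cmp C S L S a (cmp C S P L p ?\<beta>) \<oplus>\<^bsub>Hom C S S\<^esub> cmp C S T S c (cmp C S P T q ?\<beta>)"
    using a c P arrs(2) by (subst cmp_add_left) (auto simp: cmp_assoc intro: arr_intros)
  ultimately show ?thesis using arrs by metis
qed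

text \<open>Induction on the number of terms.  Write \<open>e = t + ab\<close> with \<open>ea = a\<close> and \<open>be = b\<close>, where \<open>ab\<close> is the last
  term and \<open>a : L \<rightarrow> S\<close>.  As the endomorphism ring of \<open>L\<close> is local, \<open>ba\<close> or \<open>1 - ba\<close> is invertible.  In the
  first case \<open>ab' = a(ba)\<^sup>-\<^sup>1b\<close> is an idempotent below \<open>e\<close> that splits through \<open>L\<close>, and the complement
  \<open>e - ab'\<close> kills \<open>a\<close>, hence has fewer terms.  In the second case \<open>ta = a - aba = a(1 - ba)\<close>, so the last
  term is redundant: \<open>a = ta(1 - ba)\<^sup>-\<^sup>1\<close> and \<open>e = t(1 + a(1 - ba)\<^sup>-\<^sup>1b)\<close> has fewer terms.\<close>

lemma local_sum_idempotent_splits: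
  assumes "local_sum C S n e" "S \<in> Obj C" "cmp C S S S e e = e"
  shows "\<exists>T c d. arr C T S c \<and> arr C S T d \<and> cmp C T S T d c = ident C T \<and> cmp C S T S c d = e"
  using assms
proof (induction n arbitrary: e)
  case 0
  then have e: "e = \<zero>\<^bsub>Hom C S S\<^esub>" by (auto elim: local_sum.cases)
  obtain Z where Z: "zero_object C Z" using has_zero_object by blast
  then have obj: "Z \<in> Obj C" by (simp add: zero_object_def)
  have "\<zero>\<^bsub>Hom C Z Z\<^esub> = ident C Z" using Z obj zero_object_iff_ident_eq_zero by simp
  then show ?case
    using obj \<open>S \<in> Obj C\<close> e
    by (intro exI[of _ Z] exI[of _ "\<zero>\<^bsub>Hom C Z S\<^esub>"] exI[of _ "\<zero>\<^bsub>Hom C S Z\<^esub>"]) simp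
next
  case (Suc n)
  note S = \<open>S \<in> Obj C\<close> and ee = \<open>cmp C S S S e e = e\<close>
  have e: "arr C S S e" using Suc.prems local_sum_arr by blast
  obtain s L a0 b0 where s0: "local_sum C S n s" "arr C L S a0" "arr C S L b0"
    and L: "local_ring (End_ring C L)" and e_eq: "e = s \<oplus>\<^bsub>Hom C S S\<^esub> cmp C S L S a0 b0"
    using Suc.prems(1) by (auto elim: local_sum.cases)
  have s: "arr C S S s" using s0 S local_sum_arr by blast
  have objL: "L \<in> Obj C" using s0 by (simp add: arr_def)
  define a where "a = cmp C L S S e a0"
  define b where "b = cmp C S S L b0 e"
  define t where "t = cmp C S S S e (cmp C S S S s e)"
  have ab: "arr C L S a" "arr C S L b" unfolding a_def b_def using e s0 by (auto intro: cmp_arr)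
  have lt: "local_sum C S n t" unfolding t_def using s0 e by (intro local_sum_cmp)
  have t: "arr C S S t" using lt S local_sum_arr by blast
  have ea: "cmp C L S S e a = a" unfolding a_def using e s0 ee by (simp add: cmp_assoc)
  have be: "cmp C S S L b e = b" unfolding b_def using e s0 ee by (simp add: cmp_assoc[symmetric])
  have e_tab: "e = t \<oplus>\<^bsub>Hom C S S\<^esub> cmp C S L S a b"
  proof -
    have "e = cmp C S S S e (cmp C S S S e e)" using ee by simp
    also have "\<dots> = cmp C S S S e (cmp C S S S (s \<oplus>\<^bsub>Hom C S S\<^esub> cmp C S L S a0 b0) e)"
      using e_eq by simp
    also have "\<dots> = t \<oplus>\<^bsub>Hom C S S\<^esub> cmp C S L S a b"
      unfolding t_def a_def b_def using e s s0 by (simp add: cmp_distribs cmp_arr cmp_assoc)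
    finally show ?thesis .
  qed
  let ?r = "cmp C L S L b a"
  have r: "arr C L L ?r" using ab by (auto intro: cmp_arr)
  from L r show ?case
  proof (cases rule: local_End_cases)
    case 1
    then obtain w where w: "arr C L L w" "cmp C L L L w ?r = ident C L"
      using objL Units_EndE by blast
    define b' where "b' = cmp C S L L w b"
    have b': "arr C S L b'" unfolding b'_def using w ab by (auto intro: cmp_arr)
    have b'a: "cmp C L S L b' a = ident C L" unfolding b'_def using w ab by (simp add: cmp_assoc[symmetric])
    have b'e: "cmp C S S L b' e = b'" unfolding b'_def using w ab e be by (simp add: cmp_assoc[symmetric])
    define e' where "e' = cmp C S L S a b'"
    have e': "arr C S S e'" unfolding e'_def using ab b' by (auto intro: cmp_arr)
    define e1 where "e1 = e \<ominus>\<^bsub>Hom C S S\<^esub> e'"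
    have e1: "arr C S S e1" unfolding e1_def using e e' by simp
    have e1a: "cmp C L S S e1 a = \<zero>\<^bsub>Hom C L S\<^esub>"
      unfolding e1_def e'_def using e ab b' b'a ea
      by (simp add: cmp_minus_left cmp_arr cmp_assoc[symmetric] cmp_ident_right)
    have b'e1: "cmp C S S L b' e1 = \<zero>\<^bsub>Hom C S L\<^esub>"
      unfolding e1_def e'_def using e ab b' b'a b'e
      by (simp add: cmp_minus_right cmp_arr cmp_assoc cmp_ident_left)
    have e1e: "cmp C S S S e1 e = e1"
      unfolding e1_def e'_def using e ab b' b'e ee
      by (simp add: cmp_minus_left cmp_arr cmp_assoc[symmetric])
    have e1e1: "cmp C S S S e1 e1 = e1"
    proof -
      have "cmp C S S S e1 (e \<ominus>\<^bsub>Hom C S S\<^esub> e') = e1 \<ominus>\<^bsub>Hom C S S\<^esub> cmp C S S S e1 e'"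
        using e1 e e' e1e by (simp add: cmp_minus_right)
      also have "cmp C S S S e1 e' = \<zero>\<^bsub>Hom C S S\<^esub>"
        unfolding e'_def using e1 ab b' e1a S by (simp add: cmp_assoc)
      finally show ?thesis using e1 e1_def by simp
    qed
    have "e1 = cmp C S S S e1 (cmp C S S S e e1)"
      using e1 e e1e e1e1 by (simp add: cmp_assoc)
    also have "\<dots> = cmp C S S S e1 (cmp C S S S (t \<oplus>\<^bsub>Hom C S S\<^esub> cmp C S L S a b) e1)"
      using e_tab by simp
    also have "\<dots> = cmp C S S S e1 (cmp C S S S t e1) \<oplus>\<^bsub>Hom C S S\<^esub>
        cmp C S L S (cmp C L S S e1 a) (cmp C S S L b e1)"
      using e1 t ab by (simp add: cmp_distribs cmp_arr cmp_assoc)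
    also have "\<dots> = cmp C S S S e1 (cmp C S S S t e1)"
      using e1 t ab e1a S by (simp add: cmp_arr)
    finally have "local_sum C S n e1"
      using local_sum_cmp[OF lt e1 e1] by simp
    then obtain T c d where T: "arr C T S c" "arr C S T d" "cmp C T S T d c = ident C T" "cmp C S T S c d = e1"
      using Suc.IH S e1e1 by blast
    have objT: "T \<in> Obj C" using T by (simp add: arr_def)
    have e1c: "cmp C T S S e1 c = c"
      using T by (simp add: cmp_assoc[symmetric] cmp_ident_right flip: T(4))
    have de1: "cmp C S S T d e1 = d"
      using T by (simp add: cmp_assoc cmp_ident_left flip: T(4))
    have "cmp C T S L b' c = cmp C T S L (cmp C S S L b' e1) c"
      using T(1) b' e1 e1c by (simp add: cmp_assoc[symmetric])
    then have "cmp C T S L b' c = \<zero>\<^bsub>Hom C T L\<^esub>" using b'e1 T objL by simp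
    moreover have "cmp C L S T d a = cmp C L S T d (cmp C L S S e1 a)"
      using T(2) ab e1 de1 by (simp add: cmp_assoc)
    then have "cmp C L S T d a = \<zero>\<^bsub>Hom C L T\<^esub>" using e1a T objL by simp
    ultimately have "\<exists>P \<alpha> \<beta>. arr C P S \<alpha> \<and> arr C S P \<beta> \<and> cmp C P S P \<beta> \<alpha> = ident C P \<and>
        cmp C S P S \<alpha> \<beta> = cmp C S L S a b' \<oplus>\<^bsub>Hom C S S\<^esub> cmp C S T S c d"
      using ab b' b'a T by (intro add_splittings) auto
    moreover have "cmp C S L S a b' \<oplus>\<^bsub>Hom C S S\<^esub> cmp C S T S c d = e"
      unfolding T(4) e1_def using e e' by (simp add: e'_def)
    ultimately show ?thesis by simp
  next
    case 2
    let ?u = "ident C L \<ominus>\<^bsub>Hom C L L\<^esub> ?r"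
    obtain w where u: "arr C L L ?u" and w: "arr C L L w" "cmp C L L L ?u w = ident C L"
      using 2 objL Units_EndE by blast
    have "cmp C L S S e a = cmp C L S S (t \<oplus>\<^bsub>Hom C S S\<^esub> cmp C S L S a b) a"
      using e_tab by simp
    then have "a = cmp C L S S t a \<oplus>\<^bsub>Hom C L S\<^esub> cmp C L L S a ?r"
      using ea ab t by (simp add: cmp_add_left cmp_arr cmp_assoc)
    then have "cmp C L S S t a = a \<ominus>\<^bsub>Hom C L S\<^esub> cmp C L L S a ?r"
      using minus_add_cancel(3)[of L S "cmp C L S S t a" "cmp C L L S a ?r"] t ab r by (simp add: cmp_arr)
    also have "\<dots> = cmp C L L S a ?u"
      using ab r objL by (simp add: cmp_minus_right ident_arr cmp_ident_right)
    finally have "cmp C L L S (cmp C L S S t a) w = cmp C L L S (cmp C L L S a ?u) w"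
      by simp
    then have ta: "cmp C L S S t (cmp C L L S a w) = a"
      using ab t u w by (simp add: cmp_assoc[symmetric] cmp_ident_right)
    let ?y = "ident C S \<oplus>\<^bsub>Hom C S S\<^esub> cmp C S L S (cmp C L L S a w) b"
    have y: "arr C S S ?y" using ab w S by (auto intro: arr_intros)
    have "cmp C S S S t ?y = t \<oplus>\<^bsub>Hom C S S\<^esub> cmp C S L S (cmp C L S S t (cmp C L L S a w)) b"
      using t ab w S by (simp add: cmp_add_right cmp_arr ident_arr cmp_ident_right cmp_assoc)
    also have "\<dots> = e" using ta e_tab by simp
    finally have "local_sum C S n e"
      using local_sum_cmp[OF lt ident_arr[OF S] y] e by (simp add: cmp_ident_left)
    then show ?thesis using Suc.IH S ee by blast
  qed
qed

lemma direct_sum_local_sum: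
  assumes "direct_sum C S n X" and loc: "\<And>i. i \<in> {1..n} \<Longrightarrow> local_ring (End_ring C (X i))"
  shows "local_sum C S n (ident C S)"
proof -
  obtain \<iota> \<pi> where arrs: "\<And>i. i \<in> {1..n} \<Longrightarrow> arr C (X i) S (\<iota> i) \<and> arr C S (X i) (\<pi> i)"
    and sum: "(\<Oplus>\<^bsub>Hom C S S\<^esub>i\<in>{1..n}. cmp C S (X i) S (\<iota> i) (\<pi> i)) = ident C S"
    using assms(1) unfolding direct_sum_def by blast
  have S: "S \<in> Obj C" using assms(1) by (simp add: direct_sum_def)
  interpret H: abelian_group "Hom C S S" using S Hom_abelian_group by simp
  let ?t = "\<lambda>i. cmp C S (X i) S (\<iota> i) (\<pi> i)"
  have t: "?t i \<in> carrier (Hom C S S)" if "i \<in> {1..n}" for i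
    using arrs[OF that] cmp_arr[of S "X i" "\<pi> i" S "\<iota> i"] by (simp add: arr_def)
  have "local_sum C S k (\<Oplus>\<^bsub>Hom C S S\<^esub>i\<in>{1..k}. ?t i)" if "k \<le> n" for k
    using that
  proof (induction k)
    case 0
    then show ?case using local_sum.zero by simp
  next
    case (Suc k)
    have "(\<Oplus>\<^bsub>Hom C S S\<^esub>i\<in>insert (Suc k) {1..k}. ?t i) =
        ?t (Suc k) \<oplus>\<^bsub>Hom C S S\<^esub> (\<Oplus>\<^bsub>Hom C S S\<^esub>i\<in>{1..k}. ?t i)"
      using t Suc.prems by (intro H.finsum_insert) auto
    also have "\<dots> = (\<Oplus>\<^bsub>Hom C S S\<^esub>i\<in>{1..k}. ?t i) \<oplus>\<^bsub>Hom C S S\<^esub> ?t (Suc k)"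
      using t Suc.prems by (intro H.a_comm H.finsum_closed) auto
    also have "local_sum C S (Suc k) \<dots>"
      using Suc arrs[of "Suc k"] loc[of "Suc k"] by (intro local_sum.add) auto
    finally show ?case by (simp add: atLeastAtMostSuc_conv)
  qed
  then show ?thesis using sum by force
qed

end

context krull_schmidt_category
begin

lemma idempotent_splits:
  assumes "arr C S S e" "cmp C S S S e e = e"
  obtains T c d where "arr C T S c" "arr C S T d" "cmp C T S T d c = ident C T" "cmp C S T S c d = e"
proof -
  have S: "S \<in> Obj C" using assms by (simp add: arr_def)
  obtain n X where "direct_sum C S n X" "\<forall>i\<in>{1..n}. local_ring (End_ring C (X i))"
    using krull_schmidt[OF S] by blast
  then have "local_sum C S n (ident C S)" using direct_sum_local_sum by blast
  from local_sum_cmp[OF this ident_arr[OF S] assms(1)] have "local_sum C S n e"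
    using assms by (simp add: cmp_ident_left)
  then show ?thesis using local_sum_idempotent_splits S assms(2) that by blast
qed

text \<open>A splitting of the idempotent \<open>1 - jv\<close> supplies the second summand.\<close>

lemma retraction_complement:
  assumes v: "arr C S Y v" and j: "arr C Y S j" and vj: "cmp C Y S Y v j = ident C Y"
  obtains Y' i\<^sub>2 p\<^sub>2 where "biproduct C Y Y' S j i\<^sub>2 v p\<^sub>2"
proof -
  have obj: "S \<in> Obj C" "Y \<in> Obj C" using v by (auto simp: arr_def)
  let ?jv = "cmp C S Y S j v"
  let ?e = "ident C S \<ominus>\<^bsub>Hom C S S\<^esub> ?jv"
  have arrs: "arr C S S ?jv" "arr C S S ?e" using v j obj by (auto intro: arr_intros)
  have ve: "cmp C S S Y v ?e = \<zero>\<^bsub>Hom C S Y\<^esub>"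
    using v j vj obj arrs by (simp add: cmp_minus_right ident_arr cmp_ident_right cmp_assoc cmp_ident_left)
  have ej: "cmp C Y S S ?e j = \<zero>\<^bsub>Hom C Y S\<^esub>"
    using v j vj obj arrs
    by (simp add: cmp_minus_left ident_arr cmp_ident_right cmp_assoc[symmetric] cmp_ident_left)
  have "cmp C S S S ?e ?e = ?e \<ominus>\<^bsub>Hom C S S\<^esub> cmp C S Y S j (cmp C S S Y v ?e)"
    using v j obj arrs cmp_minus_left[of S S ?e S "ident C S" ?jv]
    by (simp only: ident_arr cmp_ident_left cmp_assoc)
  also have "\<dots> = ?e" using ve arrs j obj by simp
  finally obtain T c d where T: "arr C T S c" "arr C S T d" "cmp C T S T d c = ident C T" "cmp C S T S c d = ?e"
    using idempotent_splits arrs by blast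
  have objT: "T \<in> Obj C" using T by (simp add: arr_def)
  have "cmp C T S Y v c = cmp C T S Y v (cmp C T S S (cmp C S T S c d) c)"
    using T(1-3) by (simp add: cmp_assoc[symmetric] cmp_ident_right)
  also have "\<dots> = cmp C T S Y (cmp C S S Y v ?e) c"
    unfolding T(4) using T(1) v arrs by (simp add: cmp_assoc)
  also have "\<dots> = \<zero>\<^bsub>Hom C T Y\<^esub>" using ve T(1) obj by simp
  finally have vc: "cmp C T S Y v c = \<zero>\<^bsub>Hom C T Y\<^esub>" .
  have "cmp C Y S T d j = cmp C Y S T (cmp C S S T d (cmp C S T S c d)) j"
    using T(1-3) by (simp add: cmp_assoc cmp_ident_left)
  also have "\<dots> = cmp C Y S T d (cmp C Y S S ?e j)"
    unfolding T(4) using T(2) j arrs by (simp add: cmp_assoc)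
  also have "\<dots> = \<zero>\<^bsub>Hom C Y T\<^esub>" using ej T(2) obj by simp
  finally have dj: "cmp C Y S T d j = \<zero>\<^bsub>Hom C Y T\<^esub>" .
  have "?jv \<oplus>\<^bsub>Hom C S S\<^esub> cmp C S T S c d = ident C S"
    unfolding T(4) using arrs obj by (simp add: ident_arr)
  then have "biproduct C Y T S j c v d"
    unfolding biproduct_def using v j vj T vc dj by simp
  then show ?thesis by (rule that)
qed

end


section \<open>Morphisms of the quotient category\<close>

locale k_category_with_ideal = k_category +
  fixes I :: "'b \<Rightarrow> 'b \<Rightarrow> 'c set"
  assumes ideal: "cat_ideal R C I"
begin

lemma ideal_submodule: "\<lbrakk>X \<in> Obj C; Y \<in> Obj C\<rbrakk> \<Longrightarrow> submodule (I X Y) R (Hom C X Y)"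
  using ideal by (simp add: cat_ideal_def)

lemma ideal_arr: "\<lbrakk>z \<in> I X Y; X \<in> Obj C; Y \<in> Obj C\<rbrakk> \<Longrightarrow> arr C X Y z"
  using module.submoduleE(1)[OF Hom_module ideal_submodule] by (auto simp: arr_def)

lemma ideal_add: "\<lbrakk>y \<in> I X Y; z \<in> I X Y; X \<in> Obj C; Y \<in> Obj C\<rbrakk> \<Longrightarrow> y \<oplus>\<^bsub>Hom C X Y\<^esub> z \<in> I X Y"
  using module.submoduleE(5)[OF Hom_module ideal_submodule] by blast

lemma ideal_neg: "\<lbrakk>z \<in> I X Y; X \<in> Obj C; Y \<in> Obj C\<rbrakk> \<Longrightarrow> \<ominus>\<^bsub>Hom C X Y\<^esub> z \<in> I X Y"
  using module.submoduleE(3)[OF Hom_module ideal_submodule] by blast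

lemma ideal_zero: "\<lbrakk>X \<in> Obj C; Y \<in> Obj C\<rbrakk> \<Longrightarrow> \<zero>\<^bsub>Hom C X Y\<^esub> \<in> I X Y"
  using subgroup.one_closed[OF submodule.axioms(1)[OF ideal_submodule]] by fastforce

lemma ideal_cmp_left: "\<lbrakk>z \<in> I X Y; arr C Y Z g; X \<in> Obj C\<rbrakk> \<Longrightarrow> cmp C X Y Z g z \<in> I X Z"
  using ideal arr_objs by (simp add: cat_ideal_def)

lemma ideal_cmp_right: "\<lbrakk>z \<in> I Y Z; arr C X Y f; Z \<in> Obj C\<rbrakk> \<Longrightarrow> cmp C X Y Z z f \<in> I X Z"
  using ideal arr_objs by (simp add: cat_ideal_def)

lemma ident_in_ideal_iff:
  assumes "X \<in> Obj C"
  shows "ident C X \<in> I X X \<longleftrightarrow> (\<exists>z\<in>I X X. z \<in> Units (End_ring C X))"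
proof
  assume "ident C X \<in> I X X"
  moreover have "ident C X \<in> Units (End_ring C X)"
    using assms ident_arr[of X] by (subst Units_End_iff) (auto simp: cmp_ident_left)
  ultimately show "\<exists>z\<in>I X X. z \<in> Units (End_ring C X)" by blast
next
  assume "\<exists>z\<in>I X X. z \<in> Units (End_ring C X)"
  then obtain z where "z \<in> I X X" "z \<in> Units (End_ring C X)" by blast
  then show "ident C X \<in> I X X" using assms Units_EndE ideal_cmp_right by metis
qed

lemma mem_coset_iff:
  assumes f: "arr C X Y f"
  shows "f' \<in> coset C I X Y f \<longleftrightarrow> (\<exists>z\<in>I X Y. f' = f \<oplus>\<^bsub>Hom C X Y\<^esub> z)"
proof -
  interpret H: abelian_group "Hom C X Y" using f Hom_abelian_group by (simp add: arr_def)
  show ?thesis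
    using f ideal_arr[of _ X Y] unfolding coset_def a_r_coset_def'
    by (auto simp: arr_def H.a_comm)
qed

text \<open>Equality of classes is stated with an error term \<open>z\<close> in the ideal rather than by a difference: the
  notions for the quotient category then become equations between morphisms of the original one.\<close>

lemma coset_eq_iff:
  assumes f: "arr C X Y f" and g: "arr C X Y g"
  shows "coset C I X Y f = coset C I X Y g \<longleftrightarrow> (\<exists>z\<in>I X Y. f = g \<oplus>\<^bsub>Hom C X Y\<^esub> z)"
proof -
  have obj: "X \<in> Obj C" "Y \<in> Obj C" using f by (auto simp: arr_def)
  interpret H: abelian_group "Hom C X Y" using obj Hom_abelian_group by simp
  have sub: "coset C I X Y f \<subseteq> coset C I X Y g"
    if f: "arr C X Y f" and g: "arr C X Y g" and z: "z \<in> I X Y" "f = g \<oplus>\<^bsub>Hom C X Y\<^esub> z" for f g z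
  proof
    fix x assume "x \<in> coset C I X Y f"
    then obtain y where y: "y \<in> I X Y" "x = f \<oplus>\<^bsub>Hom C X Y\<^esub> y" using mem_coset_iff[OF f] by blast
    have "x = g \<oplus>\<^bsub>Hom C X Y\<^esub> (z \<oplus>\<^bsub>Hom C X Y\<^esub> y)"
      using f g y z ideal_arr obj by (simp add: H.a_assoc arr_def)
    then show "x \<in> coset C I X Y g" using mem_coset_iff[OF g] ideal_add y z obj by blast
  qed
  show ?thesis
  proof
    assume eq: "coset C I X Y f = coset C I X Y g"
    have "f \<in> coset C I X Y f" using mem_coset_iff[OF f] ideal_zero obj f add_zero(1) by metis
    then show "\<exists>z\<in>I X Y. f = g \<oplus>\<^bsub>Hom C X Y\<^esub> z" using eq mem_coset_iff[OF g] by blast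
  next
    assume "\<exists>z\<in>I X Y. f = g \<oplus>\<^bsub>Hom C X Y\<^esub> z"
    then obtain z where z: "z \<in> I X Y" "f = g \<oplus>\<^bsub>Hom C X Y\<^esub> z" by blast
    have "g = f \<oplus>\<^bsub>Hom C X Y\<^esub> \<ominus>\<^bsub>Hom C X Y\<^esub> z"
      using z g ideal_arr[OF z(1) obj] by (simp add: H.a_assoc H.r_neg arr_def)
    then show "coset C I X Y f = coset C I X Y g"
      using sub[OF f g z] sub[OF g f ideal_neg[OF z(1) obj]] by blast
  qed
qed

lemma quot_cat_simps [simp]:
  "Obj (quot_cat C I) = Obj C" "ident (quot_cat C I) X = coset C I X X (ident C X)"
  by (simp_all add: quot_cat_def)

lemma arr_quot_iff: "arr (quot_cat C I) X Y F \<longleftrightarrow> (\<exists>f. arr C X Y f \<and> F = coset C I X Y f)"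
  by (auto simp: arr_def quot_cat_def quot_module_def A_RCOSETS_def' coset_def)

lemma arr_quot_coset [simp]: "arr C X Y f \<Longrightarrow> arr (quot_cat C I) X Y (coset C I X Y f)"
  using arr_quot_iff by blast

lemma all_arr_quot_iff:
  "(\<forall>F. arr (quot_cat C I) X Y F \<longrightarrow> P F) \<longleftrightarrow> (\<forall>f. arr C X Y f \<longrightarrow> P (coset C I X Y f))"
  using arr_quot_iff by metis

lemma cmp_quot:
  assumes f: "arr C X Y f" and g: "arr C Y Z g"
  shows "cmp (quot_cat C I) X Y Z (coset C I Y Z g) (coset C I X Y f) = coset C I X Z (cmp C X Y Z g f)"
proof -
  have obj: "X \<in> Obj C" "Y \<in> Obj C" "Z \<in> Obj C" using f g by (auto simp: arr_def)
  have eq: "coset C I X Z (cmp C X Y Z g' f') = coset C I X Z (cmp C X Y Z g f)"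
    if g': "g' \<in> coset C I Y Z g" and f': "f' \<in> coset C I X Y f" for g' f'
  proof -
    obtain y z where y: "y \<in> I Y Z" "g' = g \<oplus>\<^bsub>Hom C Y Z\<^esub> y" and z: "z \<in> I X Y" "f' = f \<oplus>\<^bsub>Hom C X Y\<^esub> z"
      using f' g' mem_coset_iff f g by blast
    note arrs = f g ideal_arr[OF y(1) obj(2,3)] ideal_arr[OF z(1) obj(1,2)]
    have 1: "cmp C X Y Z g f \<oplus>\<^bsub>Hom C X Z\<^esub> cmp C X Y Z y f = cmp C X Y Z g' f"
      using arrs y by (simp add: cmp_add_left)
    have "coset C I X Z (cmp C X Y Z g' f) = coset C I X Z (cmp C X Y Z g f)"
      using ideal_cmp_right[OF y(1) f obj(3)] arrs y 1[symmetric] by (subst coset_eq_iff) (auto intro: arr_intros)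
    moreover have g'': "arr C Y Z g'" and f'': "arr C X Y f'" using arrs y z by auto
    have "cmp C X Y Z g' f' = cmp C X Y Z g' f \<oplus>\<^bsub>Hom C X Z\<^esub> cmp C X Y Z g' z"
      unfolding z(2) using arrs g'' by (simp add: cmp_add_right)
    then have "coset C I X Z (cmp C X Y Z g' f') = coset C I X Z (cmp C X Y Z g' f)"
      using ideal_cmp_left[OF z(1) g'' obj(1)] coset_eq_iff[OF cmp_arr[OF f'' g''] cmp_arr[OF f g'']] by blast
    ultimately show ?thesis by simp
  qed
  have "f \<in> coset C I X Y f" "g \<in> coset C I Y Z g"
    using mem_coset_iff ideal_zero obj f g add_zero(1) by metis+
  then have ne: "coset C I X Y f \<noteq> {}" "coset C I Y Z g \<noteq> {}" by blast+
  have "cmp (quot_cat C I) X Y Z (coset C I Y Z g) (coset C I X Y f) =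
      (\<Union>g'\<in>coset C I Y Z g. \<Union>f'\<in>coset C I X Y f. coset C I X Z (cmp C X Y Z g f))"
    unfolding quot_cat_def kcat.simps by (intro SUP_cong refl eq)
  then show ?thesis using ne by simp
qed

lemma is_section_quot_iff:
  assumes f: "arr C X Y f"
  shows "is_section (quot_cat C I) X Y (coset C I X Y f) \<longleftrightarrow>
    (\<exists>g. \<exists>z\<in>I X X. arr C Y X g \<and> ident C X = cmp C X Y X g f \<oplus>\<^bsub>Hom C X X\<^esub> z)"
proof -
  have X: "arr C X X (ident C X)" using f by (simp add: arr_objs ident_arr)
  have "cmp (quot_cat C I) X Y X (coset C I Y X g) (coset C I X Y f) = coset C I X X (ident C X) \<longleftrightarrow>
      (\<exists>z\<in>I X X. ident C X = cmp C X Y X g f \<oplus>\<^bsub>Hom C X X\<^esub> z)" if "arr C Y X g" for g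
    unfolding cmp_quot[OF f that] using coset_eq_iff[OF X cmp_arr[OF f that]] by metis
  then show ?thesis using f by (auto simp: is_section_def arr_quot_iff)
qed

lemma is_retraction_quot_iff:
  assumes f: "arr C X Y f"
  shows "is_retraction (quot_cat C I) X Y (coset C I X Y f) \<longleftrightarrow>
    (\<exists>g. \<exists>z\<in>I Y Y. arr C Y X g \<and> ident C Y = cmp C Y X Y f g \<oplus>\<^bsub>Hom C Y Y\<^esub> z)"
proof -
  have Y: "arr C Y Y (ident C Y)" using f by (simp add: arr_objs ident_arr)
  have "cmp (quot_cat C I) Y X Y (coset C I X Y f) (coset C I Y X g) = coset C I Y Y (ident C Y) \<longleftrightarrow>
      (\<exists>z\<in>I Y Y. ident C Y = cmp C Y X Y f g \<oplus>\<^bsub>Hom C Y Y\<^esub> z)" if "arr C Y X g" for g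
    unfolding cmp_quot[OF that f] using coset_eq_iff[OF Y cmp_arr[OF that f]] by metis
  then show ?thesis using f by (auto simp: is_retraction_def arr_quot_iff)
qed

lemma left_almost_split_quot_iff:
  assumes f: "arr C X Y f"
  shows "left_almost_split (quot_cat C I) X Y (coset C I X Y f) \<longleftrightarrow>
    \<not> is_section (quot_cat C I) X Y (coset C I X Y f) \<and>
    (\<forall>U u. arr C X U u \<longrightarrow> \<not> is_section (quot_cat C I) X U (coset C I X U u) \<longrightarrow>
      (\<exists>v. \<exists>z\<in>I X U. arr C Y U v \<and> u = cmp C X Y U v f \<oplus>\<^bsub>Hom C X U\<^esub> z))"
proof -
  have "(\<exists>V. arr (quot_cat C I) Y U V \<and> coset C I X U u = cmp (quot_cat C I) X Y U V (coset C I X Y f)) \<longleftrightarrow>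
      (\<exists>v. \<exists>z\<in>I X U. arr C Y U v \<and> u = cmp C X Y U v f \<oplus>\<^bsub>Hom C X U\<^esub> z)" if u: "arr C X U u" for U u
  proof -
    have "coset C I X U u = cmp (quot_cat C I) X Y U (coset C I Y U v) (coset C I X Y f) \<longleftrightarrow>
        (\<exists>z\<in>I X U. u = cmp C X Y U v f \<oplus>\<^bsub>Hom C X U\<^esub> z)" if "arr C Y U v" for v
      unfolding cmp_quot[OF f that] using coset_eq_iff[OF u cmp_arr[OF f that]] .
    then show ?thesis unfolding arr_quot_iff by blast
  qed
  then show ?thesis using f by (simp add: left_almost_split_def all_arr_quot_iff)
qed

lemma irreducible_quot_iff:
  assumes f: "arr C X Y f"
  shows "irreducible_morphism (quot_cat C I) X Y (coset C I X Y f) \<longleftrightarrow>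
    \<not> is_section (quot_cat C I) X Y (coset C I X Y f) \<and>
    \<not> is_retraction (quot_cat C I) X Y (coset C I X Y f) \<and>
    (\<forall>Z g h. arr C X Z g \<longrightarrow> arr C Z Y h \<longrightarrow> (\<exists>z\<in>I X Y. f = cmp C X Z Y h g \<oplus>\<^bsub>Hom C X Y\<^esub> z) \<longrightarrow>
      is_retraction (quot_cat C I) Z Y (coset C I Z Y h) \<or> is_section (quot_cat C I) X Z (coset C I X Z g))"
proof -
  have "coset C I X Y f = cmp (quot_cat C I) X Z Y (coset C I Z Y h) (coset C I X Z g) \<longleftrightarrow>
      (\<exists>z\<in>I X Y. f = cmp C X Z Y h g \<oplus>\<^bsub>Hom C X Y\<^esub> z)" if "arr C X Z g" "arr C Z Y h" for Z g h
    unfolding cmp_quot[OF that] using coset_eq_iff[OF f cmp_arr[OF that]] .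
  then show ?thesis using f by (simp add: irreducible_morphism_def all_arr_quot_iff)
qed

lemma is_section_coset:
  assumes "is_section C X Y f"
  shows "is_section (quot_cat C I) X Y (coset C I X Y f)"
proof -
  obtain g where g: "arr C X Y f" "arr C Y X g" "cmp C X Y X g f = ident C X"
    using assms by (auto simp: is_section_def)
  then show ?thesis
    using ideal_zero[of X X] by (subst is_section_quot_iff) (auto simp: arr_objs ident_arr intro!: exI[of _ g] bexI[of _ "\<zero>\<^bsub>Hom C X X\<^esub>"])
qed

text \<open>A left inverse modulo the ideal is a left inverse up to a radical morphism, hence up to an
  automorphism.\<close>

lemma is_section_if_coset:
  assumes f: "arr C X Y f" and rad: "I X X \<subseteq> rad C X X"
    and sec: "is_section (quot_cat C I) X Y (coset C I X Y f)"
  shows "is_section C X Y f"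
proof -
  have X: "X \<in> Obj C" using f by (simp add: arr_def)
  obtain g z where g: "z \<in> I X X" "arr C Y X g" "ident C X = cmp C X Y X g f \<oplus>\<^bsub>Hom C X X\<^esub> z"
    using sec is_section_quot_iff[OF f] by blast
  have "cmp C X Y X g f \<in> Units (End_ring C X)"
    using g rad f by (intro Units_End_if_ident_eq_add_rad[of X _ z] cmp_arr) auto
  then obtain w where w: "arr C X X w" "cmp C X X X w (cmp C X Y X g f) = ident C X"
    using X Units_EndE by blast
  then show ?thesis
    using f g by (auto simp: is_section_def cmp_assoc intro!: exI[of _ "cmp C Y X X w g"] cmp_arr)
qed

lemma is_retraction_if_coset:
  assumes f: "arr C X Y f" and rad: "I Y Y \<subseteq> rad C Y Y"
    and ret: "is_retraction (quot_cat C I) X Y (coset C I X Y f)"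
  shows "is_retraction C X Y f"
proof -
  have Y: "Y \<in> Obj C" using f by (simp add: arr_def)
  obtain g z where g: "z \<in> I Y Y" "arr C Y X g" "ident C Y = cmp C Y X Y f g \<oplus>\<^bsub>Hom C Y Y\<^esub> z"
    using ret is_retraction_quot_iff[OF f] by blast
  have "cmp C Y X Y f g \<in> Units (End_ring C Y)"
    using g rad f by (intro Units_End_if_ident_eq_add_rad[of Y _ z] cmp_arr) auto
  then obtain w where w: "arr C Y Y w" "cmp C Y Y Y (cmp C Y X Y f g) w = ident C Y"
    using Y Units_EndE by blast
  then show ?thesis
    using f g by (auto simp: is_retraction_def cmp_assoc[symmetric] intro!: exI[of _ "cmp C Y Y X g w"] cmp_arr)
qed

text \<open>The identity of a summand is obtained from the identity of the sum by composing with injection and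
  projection, so a summand outside the ideal keeps the identity of the sum outside the ideal.\<close>

lemma ident_eq_zero_if_ident_mem_ideal:
  assumes sum: "direct_sum C X n Xs" and Xs: "\<forall>i\<in>{1..n}. ident C (Xs i) \<notin> I (Xs i) (Xs i)"
    and id: "ident C X \<in> I X X"
  shows "n = 0 \<and> ident C X = \<zero>\<^bsub>Hom C X X\<^esub>"
proof -
  obtain \<iota> \<pi> where arrs: "\<And>i. i \<in> {1..n} \<Longrightarrow> arr C (Xs i) X (\<iota> i) \<and> arr C X (Xs i) (\<pi> i)"
    and inv: "\<And>i. i \<in> {1..n} \<Longrightarrow> cmp C (Xs i) X (Xs i) (\<pi> i) (\<iota> i) = ident C (Xs i)"
    and sum_id: "(\<Oplus>\<^bsub>Hom C X X\<^esub>i\<in>{1..n}. cmp C X (Xs i) X (\<iota> i) (\<pi> i)) = ident C X"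
    using sum unfolding direct_sum_def by fastforce
  have n: "n = 0"
  proof (rule ccontr)
    assume "n \<noteq> 0"
    then have 1: "1 \<in> {1..n}" by simp
    note a = arrs[OF 1]
    have "cmp C (Xs 1) X (Xs 1) (\<pi> 1) (cmp C (Xs 1) X X (ident C X) (\<iota> 1)) \<in> I (Xs 1) (Xs 1)"
      using a id arr_objs by (meson ideal_cmp_left ideal_cmp_right)
    then show False using a inv[OF 1] Xs 1 by (simp add: cmp_ident_left)
  qed
  have X: "X \<in> Obj C" using sum by (simp add: direct_sum_def)
  interpret H: abelian_group "Hom C X X" using X Hom_abelian_group by simp
  show ?thesis using sum_id n by simp
qed

text \<open>The object \<open>X\<close> is zero in the quotient, where every morphism out of it is a section.\<close>

lemma not_left_almost_split_quot_if_ident_mem: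
  assumes "ident C X \<in> I X X" "arr C X Y f"
  shows "\<not> left_almost_split (quot_cat C I) X Y (coset C I X Y f)"
proof -
  have obj: "X \<in> Obj C" "Y \<in> Obj C" using assms by (auto simp: arr_def)
  have "ident C X = cmp C X Y X \<zero>\<^bsub>Hom C Y X\<^esub> f \<oplus>\<^bsub>Hom C X X\<^esub> ident C X"
    using assms obj by (simp add: ident_arr)
  then have "is_section (quot_cat C I) X Y (coset C I X Y f)"
    using assms is_section_quot_iff obj zero_arr by blast
  then show ?thesis by (simp add: left_almost_split_def)
qed

text \<open>The endomorphisms of \<open>X\<close> that factor through \<open>f\<close> modulo the ideal are closed under sums.  If
  every projection were a non-section in the quotient, all summands of \<open>1\<^sub>X = \<Sum> \<iota>\<^sub>i\<pi>\<^sub>i\<close> would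
  be of this kind, which would make \<open>f\<close> a section there.\<close>

lemma ex_projection_section_quot:
  assumes f: "arr C X Y f" and las: "left_almost_split (quot_cat C I) X Y (coset C I X Y f)"
    and arrs: "\<And>i. i \<in> {1..n} \<Longrightarrow> arr C (Xs i) X (\<iota> i) \<and> arr C X (Xs i) (\<pi> i)"
    and id: "(\<Oplus>\<^bsub>Hom C X X\<^esub>i\<in>{1..n::nat}. cmp C X (Xs i) X (\<iota> i) (\<pi> i)) = ident C X"
  shows "\<exists>k\<in>{1..n}. is_section (quot_cat C I) X (Xs k) (coset C I X (Xs k) (\<pi> k))"
proof -
  have obj: "X \<in> Obj C" "Y \<in> Obj C" using f by (auto simp: arr_def)
  note las' = las[unfolded left_almost_split_quot_iff[OF f] is_section_quot_iff[OF f]]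
  show ?thesis
  proof (rule ccontr)
    assume no: "\<not> ?thesis"
    have "\<exists>v. \<exists>z\<in>I X X. arr C Y X v \<and>
        (\<Oplus>\<^bsub>Hom C X X\<^esub>i\<in>{1..n}. cmp C X (Xs i) X (\<iota> i) (\<pi> i)) = cmp C X Y X v f \<oplus>\<^bsub>Hom C X X\<^esub> z"
    proof (rule finsum_induct_arr[where P = "\<lambda>s. \<exists>v. \<exists>z\<in>I X X. arr C Y X v \<and> s = cmp C X Y X v f \<oplus>\<^bsub>Hom C X X\<^esub> z"])
      show "\<exists>v. \<exists>z\<in>I X X. arr C Y X v \<and> \<zero>\<^bsub>Hom C X X\<^esub> = cmp C X Y X v f \<oplus>\<^bsub>Hom C X X\<^esub> z"
        using f obj ideal_zero[of X X]
        by (intro exI[of _ "\<zero>\<^bsub>Hom C Y X\<^esub>"] bexI[of _ "\<zero>\<^bsub>Hom C X X\<^esub>"]) simp_all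
      fix i s assume i: "i \<in> {1..n}"
        and "\<exists>v. \<exists>z\<in>I X X. arr C Y X v \<and> s = cmp C X Y X v f \<oplus>\<^bsub>Hom C X X\<^esub> z"
      then obtain v z where v: "z \<in> I X X" "arr C Y X v" "s = cmp C X Y X v f \<oplus>\<^bsub>Hom C X X\<^esub> z" by blast
      have "\<not> is_section (quot_cat C I) X (Xs i) (coset C I X (Xs i) (\<pi> i))" using no i by blast
      then obtain v' z' where v': "z' \<in> I X (Xs i)" "arr C Y (Xs i) v'" "\<pi> i = cmp C X Y (Xs i) v' f \<oplus>\<^bsub>Hom C X (Xs i)\<^esub> z'"
        using las' arrs[OF i] by blast
      have objs: "Xs i \<in> Obj C" using v' by (simp add: arr_def)
      note a = arrs[OF i] v' v f obj ideal_arr[OF v(1)] ideal_arr[OF v'(1) obj(1) objs]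
      let ?iv = "cmp C Y (Xs i) X (\<iota> i) v'" and ?iz = "cmp C X (Xs i) X (\<iota> i) z'"
      have iv: "arr C Y X ?iv" and iz: "?iz \<in> I X X"
        using a by (auto intro: cmp_arr ideal_cmp_left)
      note izarr = ideal_arr[OF iz obj(1,1)] and zarr = ideal_arr[OF v(1) obj(1,1)]
      have "cmp C X (Xs i) X (\<iota> i) (\<pi> i) = cmp C X Y X ?iv f \<oplus>\<^bsub>Hom C X X\<^esub> ?iz"
        unfolding v'(3) using a by (simp add: cmp_add_right cmp_arr cmp_assoc)
      moreover interpret H: abelian_group "Hom C X X" using obj Hom_abelian_group by simp
      have "(cmp C X Y X ?iv f \<oplus>\<^bsub>Hom C X X\<^esub> ?iz) \<oplus>\<^bsub>Hom C X X\<^esub> (cmp C X Y X v f \<oplus>\<^bsub>Hom C X X\<^esub> z) =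
          (cmp C X Y X ?iv f \<oplus>\<^bsub>Hom C X X\<^esub> cmp C X Y X v f) \<oplus>\<^bsub>Hom C X X\<^esub> (?iz \<oplus>\<^bsub>Hom C X X\<^esub> z)"
        using izarr zarr cmp_arr[OF f iv] cmp_arr[OF f v(2)] by (simp add: H.a_ac arr_def)
      ultimately have "cmp C X (Xs i) X (\<iota> i) (\<pi> i) \<oplus>\<^bsub>Hom C X X\<^esub> s =
          cmp C X Y X (?iv \<oplus>\<^bsub>Hom C Y X\<^esub> v) f \<oplus>\<^bsub>Hom C X X\<^esub> (?iz \<oplus>\<^bsub>Hom C X X\<^esub> z)"
        using v(2,3) iv f by (simp add: cmp_add_left)
      then show "\<exists>v. \<exists>z\<in>I X X. arr C Y X v \<and>
          cmp C X (Xs i) X (\<iota> i) (\<pi> i) \<oplus>\<^bsub>Hom C X X\<^esub> s = cmp C X Y X v f \<oplus>\<^bsub>Hom C X X\<^esub> z"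
        using add_arr[OF iv v(2)] ideal_add[OF iz v(1) obj(1,1)] by blast
    qed (use arrs obj in \<open>auto intro: cmp_arr\<close>)
    then show False using las' unfolding id by blast
  qed
qed

text \<open>A direct sum with at least two terms would have, besides a projection that is a section in the
  quotient, a second summand whose identity lies in the ideal.\<close>

lemma indecomposable_if_left_almost_split_quot:
  assumes sum: "direct_sum C X n Xs"
    and Xs: "\<forall>i\<in>{1..n}. indecomposable C (Xs i) \<and> ident C (Xs i) \<notin> I (Xs i) (Xs i)"
    and f: "arr C X Y f" and las: "left_almost_split (quot_cat C I) X Y (coset C I X Y f)"
  shows "indecomposable C X"
proof -
  obtain \<iota> \<pi> where arrs: "\<And>i. i \<in> {1..n} \<Longrightarrow> arr C (Xs i) X (\<iota> i) \<and> arr C X (Xs i) (\<pi> i)"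
    and orth: "\<And>i j. \<lbrakk>i \<in> {1..n}; j \<in> {1..n}\<rbrakk> \<Longrightarrow> cmp C (Xs i) X (Xs j) (\<pi> j) (\<iota> i) =
        (if i = j then ident C (Xs i) else \<zero>\<^bsub>Hom C (Xs i) (Xs j)\<^esub>)"
    and id: "(\<Oplus>\<^bsub>Hom C X X\<^esub>i\<in>{1..n}. cmp C X (Xs i) X (\<iota> i) (\<pi> i)) = ident C X"
    using sum unfolding direct_sum_def by blast
  have obj: "X \<in> Obj C" "Y \<in> Obj C" using f by (auto simp: arr_def)
  obtain k where k: "k \<in> {1..n}" and "is_section (quot_cat C I) X (Xs k) (coset C I X (Xs k) (\<pi> k))"
    using ex_projection_section_quot[OF f las arrs id] by blast
  then obtain s z where s: "z \<in> I X X" "arr C (Xs k) X s" "ident C X = cmp C X (Xs k) X s (\<pi> k) \<oplus>\<^bsub>Hom C X X\<^esub> z"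
    using arrs[OF k] is_section_quot_iff by blast
  \<comment> \<open>Since \<open>\<pi>\<^sub>k\<iota>\<^sub>l = 0\<close> for \<open>l \<noteq> k\<close>, a left inverse of \<open>\<pi>\<^sub>k\<close> modulo the ideal forces \<open>\<iota>\<^sub>l\<close> into
    the ideal.\<close>
  have single: "{1..n} = {k}"
  proof -
    have "l = k" if l: "l \<in> {1..n}" for l
    proof (rule ccontr)
      assume "l \<noteq> k"
      have objl: "Xs l \<in> Obj C" using arrs[OF l] by (simp add: arr_def)
      have "\<iota> l = cmp C (Xs l) X X (ident C X) (\<iota> l)" using arrs[OF l] by (simp add: cmp_ident_left)
      also have "\<dots> = cmp C (Xs l) X X z (\<iota> l)"
        unfolding s(3) using arrs[OF l] arrs[OF k] s(2) ideal_arr[OF s(1) obj(1,1)] orth[OF l k] \<open>l \<noteq> k\<close> objl obj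
        by (simp add: cmp_add_left cmp_arr cmp_assoc[symmetric])
      also have "\<dots> \<in> I (Xs l) X" using s(1) arrs[OF l] obj by (intro ideal_cmp_right) auto
      finally have "cmp C (Xs l) X (Xs l) (\<pi> l) (\<iota> l) \<in> I (Xs l) (Xs l)"
        using arrs[OF l] objl by (intro ideal_cmp_left) auto
      then show False using Xs l orth[OF l l] by simp
    qed
    then show ?thesis using k by blast
  qed
  let ?L = "Xs k"
  note kk = arrs[OF k]
  have pi: "cmp C ?L X ?L (\<pi> k) (\<iota> k) = ident C ?L" using orth[OF k k] by simp
  interpret H: abelian_group "Hom C X X" using obj Hom_abelian_group by simp
  have "(\<Oplus>\<^bsub>Hom C X X\<^esub>i\<in>{k}. cmp C X (Xs i) X (\<iota> i) (\<pi> i)) = cmp C X ?L X (\<iota> k) (\<pi> k) \<oplus>\<^bsub>Hom C X X\<^esub> \<zero>\<^bsub>Hom C X X\<^esub>"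
    using cmp_arr[of X ?L "\<pi> k" X "\<iota> k"] kk by (subst H.finsum_insert) (auto simp: arr_def)
  then have ip: "cmp C X ?L X (\<iota> k) (\<pi> k) = ident C X"
    using id kk unfolding single by (simp add: cmp_arr)
  show ?thesis using indecomposable_iso[of ?L X "\<iota> k" "\<pi> k"] kk pi ip Xs k by blast
qed

end


section \<open>Minimal left almost split morphisms modulo an admissible ideal\<close>

locale admissible_ideal_category = krull_schmidt_category +
  fixes I :: "'b \<Rightarrow> 'b \<Rightarrow> 'c set"
  assumes admissible: "admissible_ideal R C I"

sublocale admissible_ideal_category \<subseteq> k_category_with_ideal
  using admissible by unfold_locales (simp add: admissible_ideal_def)

context admissible_ideal_category
begin

text \<open>Admissibility concerns indecomposables only.  The entries of a morphism of the ideal between the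
  summands lie in the ideal, thus in the square of the radical, and the radical is detected on entries.\<close>

lemma ideal_subset_rad:
  assumes X: "direct_sum C X n Xs" "\<forall>i\<in>{1..n}. indecomposable C (Xs i) \<and> ident C (Xs i) \<notin> I (Xs i) (Xs i)"
    and Y: "direct_sum C Y m Ys" "\<forall>j\<in>{1..m}. indecomposable C (Ys j) \<and> ident C (Ys j) \<notin> I (Ys j) (Ys j)"
  shows "I X Y \<subseteq> rad C X Y"
proof
  fix z assume z: "z \<in> I X Y"
  have obj: "X \<in> Obj C" "Y \<in> Obj C" using X Y by (auto simp: direct_sum_def)
  show "z \<in> rad C X Y"
  proof (rule rad_into_direct_sum[OF Y(1)])
    show "arr C X Y z" using z obj by (rule ideal_arr)
    fix j p assume j: "j \<in> {1..m}" and p: "arr C Y (Ys j) p"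
    have pz: "cmp C X Y (Ys j) p z \<in> I X (Ys j)" using z p obj(1) by (rule ideal_cmp_left)
    have Yj: "Ys j \<in> Obj C" using p by (simp add: arr_def)
    show "cmp C X Y (Ys j) p z \<in> rad C X (Ys j)"
    proof (rule rad_from_direct_sum[OF X(1)])
      show "arr C X (Ys j) (cmp C X Y (Ys j) p z)" using pz obj(1) Yj by (rule ideal_arr)
      fix i q assume i: "i \<in> {1..n}" and q: "arr C (Xs i) X q"
      have "cmp C (Xs i) X (Ys j) (cmp C X Y (Ys j) p z) q \<in> I (Xs i) (Ys j)"
        using pz q Yj by (rule ideal_cmp_right)
      also have "I (Xs i) (Ys j) \<subseteq> rad2 R C (Xs i) (Ys j)"
        using admissible X(2) Y(2) i j by (simp add: admissible_ideal_def)
      also have "\<dots> \<subseteq> rad C (Xs i) (Ys j)" using q Yj by (intro rad2_subset_rad) (auto simp: arr_def)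
      finally show "cmp C (Xs i) X (Ys j) (cmp C X Y (Ys j) p z) q \<in> rad C (Xs i) (Ys j)" .
    qed
  qed
qed

lemma ideal_factors_minimal_left_almost_split:
  assumes "minimal_left_almost_split C X S h" "ident C X \<notin> I X X" "z \<in> I X M" "M \<in> Obj C"
  obtains w where "w \<in> I S M" "z = cmp C X S M w h"
  using admissible assms unfolding admissible_ideal_def by metis

text \<open>The first half of the equivalence.  Membership of \<open>1\<^sub>Y\<^sub>'\<close> in the ideal makes the component \<open>g\<close>
  invisible in the quotient; irreducibility comes from minimality of \<open>(f, g)\<close>, once the error
  terms in the ideal are factored through \<open>(f, g)\<close>.\<close>

lemma irreducible_left_almost_split_quot:
  assumes f: "arr C X Y f" and g: "arr C X Y' g" and Y': "ident C Y' \<in> I Y' Y'"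
    and S: "biproduct C Y Y' S i\<^sub>1 i\<^sub>2 p\<^sub>1 p\<^sub>2"
    and mlas: "minimal_left_almost_split C X S (cmp C X Y S i\<^sub>1 f \<oplus>\<^bsub>Hom C X S\<^esub> cmp C X Y' S i\<^sub>2 g)"
    and radX: "I X X \<subseteq> rad C X X" and radY: "I Y Y \<subseteq> rad C Y Y"
    and X: "ident C X \<notin> I X X" and Y: "ident C Y \<notin> I Y Y"
  shows "irreducible_morphism (quot_cat C I) X Y (coset C I X Y f)"
    and "left_almost_split (quot_cat C I) X Y (coset C I X Y f)"
proof -
  define h where "h = cmp C X Y S i\<^sub>1 f \<oplus>\<^bsub>Hom C X S\<^esub> cmp C X Y' S i\<^sub>2 g"
  have ip: "arr C Y S i\<^sub>1" "arr C Y' S i\<^sub>2" "arr C S Y p\<^sub>1" "cmp C Y S Y p\<^sub>1 i\<^sub>1 = ident C Y"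
    "cmp C Y' S Y p\<^sub>1 i\<^sub>2 = \<zero>\<^bsub>Hom C Y' Y\<^esub>"
    using S by (auto simp: biproduct_def)
  have obj: "X \<in> Obj C" "Y \<in> Obj C" "S \<in> Obj C" "Y' \<in> Obj C" using f ip by (auto simp: arr_def)
  have h: "arr C X S h" unfolding h_def using ip f g by (auto intro: arr_intros)
  have ph: "cmp C X S Y p\<^sub>1 h = f"
    unfolding h_def using f g ip obj by (simp add: cmp_add_right cmp_arr cmp_assoc cmp_ident_left)
  have min: "left_minimal C X S h" and nsec: "\<not> is_section C X S h"
    and las: "\<And>U u. \<lbrakk>arr C X U u; \<not> is_section C X U u\<rbrakk> \<Longrightarrow> \<exists>v. arr C S U v \<and> u = cmp C X S U v h"
    using mlas unfolding h_def[symmetric] minimal_left_almost_split_def left_almost_split_def by auto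
  have nsecf: "\<not> is_section C X Y f"
  proof
    assume "is_section C X Y f"
    then obtain r where r: "arr C Y X r" "cmp C X Y X r f = ident C X" by (auto simp: is_section_def)
    then have "cmp C X S X (cmp C S Y X r p\<^sub>1) h = ident C X"
      using ph h ip by (simp add: cmp_assoc[symmetric])
    then show False using nsec h r ip by (auto simp: is_section_def intro: cmp_arr)
  qed
  have nsecq: "\<not> is_section (quot_cat C I) X Y (coset C I X Y f)"
    using is_section_if_coset[OF f radX] nsecf by blast
  show "left_almost_split (quot_cat C I) X Y (coset C I X Y f)"
    unfolding left_almost_split_quot_iff[OF f]
  proof (intro conjI allI impI nsecq)
    fix U u assume u: "arr C X U u" and "\<not> is_section (quot_cat C I) X U (coset C I X U u)"
    then have "\<not> is_section C X U u" using is_section_coset by blast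
    then obtain v where v: "arr C S U v" "u = cmp C X S U v h" using las u by blast
    have U: "U \<in> Obj C" using u by (simp add: arr_def)
    let ?z = "cmp C X Y' U (cmp C Y' S U v i\<^sub>2) g"
    have "g = cmp C X Y' Y' (ident C Y') g" using g by (simp add: cmp_ident_left)
    then have "g \<in> I X Y'" using ideal_cmp_right[OF Y' g obj(4)] by simp
    then have "?z \<in> I X U" using v ip obj by (intro ideal_cmp_left cmp_arr)
    moreover have "u = cmp C X Y U (cmp C Y S U v i\<^sub>1) f \<oplus>\<^bsub>Hom C X U\<^esub> ?z"
      unfolding v(2) h_def using v ip f g by (simp add: cmp_add_right cmp_arr cmp_assoc)
    ultimately show "\<exists>w. \<exists>z\<in>I X U. arr C Y U w \<and> u = cmp C X Y U w f \<oplus>\<^bsub>Hom C X U\<^esub> z"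
      using v ip cmp_arr by blast
  qed
  \<comment> \<open>If \<open>fj = 1\<close>, then \<open>1 - jf\<close> kills \<open>j \<noteq> 0\<close>, so it is not a section and factors through \<open>h\<close>.  So
    does \<open>jf = jp\<^sub>1h\<close>, and therefore \<open>1 = (1 - jf) + jf\<close>, which would make \<open>h\<close> a section.\<close>
  have nretf: "\<not> is_retraction C X Y f"
  proof
    assume "is_retraction C X Y f"
    then obtain j where j: "arr C Y X j" "cmp C Y X Y f j = ident C Y" by (auto simp: is_retraction_def)
    let ?jf = "cmp C X Y X j f"
    let ?e = "ident C X \<ominus>\<^bsub>Hom C X X\<^esub> ?jf"
    have arrs: "arr C X X ?jf" "arr C X X ?e" using f j obj by (auto intro: arr_intros)
    have ej: "cmp C Y X X ?e j = \<zero>\<^bsub>Hom C Y X\<^esub>"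
      using f j obj arrs
      by (simp add: cmp_minus_left ident_arr cmp_ident_left cmp_ident_right cmp_assoc[symmetric])
    have "\<not> is_section C X X ?e"
    proof
      assume "is_section C X X ?e"
      then obtain s where s: "arr C X X s" "cmp C X X X s ?e = ident C X" by (auto simp: is_section_def)
      have "j = cmp C Y X X (cmp C X X X s ?e) j" using s j by (simp add: cmp_ident_left)
      also have "\<dots> = cmp C Y X X s (cmp C Y X X ?e j)" using s(1) j arrs by (simp only: cmp_assoc)
      also have "\<dots> = \<zero>\<^bsub>Hom C Y X\<^esub>" using ej s obj by simp
      finally have "ident C Y = \<zero>\<^bsub>Hom C Y Y\<^esub>" using j f obj by simp
      then show False using Y ideal_zero obj by simp
    qed
    then obtain v where v: "arr C S X v" "?e = cmp C X S X v h" using las arrs by blast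
    let ?w = "v \<oplus>\<^bsub>Hom C S X\<^esub> cmp C S Y X j p\<^sub>1"
    have "cmp C X S X ?w h = ?e \<oplus>\<^bsub>Hom C X X\<^esub> ?jf"
      using v h j ip ph by (simp add: cmp_add_left cmp_arr cmp_assoc[symmetric])
    also have "\<dots> = ident C X" using arrs obj by (simp add: ident_arr)
    finally have "cmp C X S X ?w h = ident C X" .
    moreover have "arr C S X ?w" using v j ip by (auto intro: arr_intros)
    ultimately show False using nsec h unfolding is_section_def by blast
  qed
  show "irreducible_morphism (quot_cat C I) X Y (coset C I X Y f)"
    unfolding irreducible_quot_iff[OF f]
  proof (intro conjI allI impI nsecq)
    show "\<not> is_retraction (quot_cat C I) X Y (coset C I X Y f)"
      using is_retraction_if_coset[OF f radY] nretf by blast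
    fix Z a b assume a: "arr C X Z a" and b: "arr C Z Y b"
      and "\<exists>z\<in>I X Y. f = cmp C X Z Y b a \<oplus>\<^bsub>Hom C X Y\<^esub> z"
    then obtain z where z: "z \<in> I X Y" "f = cmp C X Z Y b a \<oplus>\<^bsub>Hom C X Y\<^esub> z" by blast
    show "is_retraction (quot_cat C I) Z Y (coset C I Z Y b) \<or> is_section (quot_cat C I) X Z (coset C I X Z a)"
    proof (rule disjCI)
      assume "\<not> is_section (quot_cat C I) X Z (coset C I X Z a)"
      then have "\<not> is_section C X Z a" using is_section_coset by blast
      then obtain v where v: "arr C S Z v" "a = cmp C X S Z v h" using las a by blast
      obtain w where w: "w \<in> I S Y" "z = cmp C X S Y w h"
        using ideal_factors_minimal_left_almost_split[OF mlas X z(1) obj(2)] unfolding h_def by blast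
      have warr: "arr C S Y w" using w obj ideal_arr by blast
      let ?bv = "cmp C S Z Y b v"
      have bv: "arr C S Y ?bv" using b v by (auto intro: cmp_arr)
      have "cmp C X S Y p\<^sub>1 h = cmp C X S Y (?bv \<oplus>\<^bsub>Hom C S Y\<^esub> w) h"
        using ph z(2) v w(2) h b warr bv by (simp add: cmp_add_left cmp_assoc)
      then obtain t where t: "t \<in> rad C S Y" "p\<^sub>1 = (?bv \<oplus>\<^bsub>Hom C S Y\<^esub> w) \<oplus>\<^bsub>Hom C S Y\<^esub> t"
        using left_minimal_cancel[OF min ip(3)] bv warr add_arr by metis
      note tarr = rad_arr[OF t(1)]
      let ?bvi = "cmp C Y S Y ?bv i\<^sub>1" and ?wi = "cmp C Y S Y w i\<^sub>1" and ?ti = "cmp C Y S Y t i\<^sub>1"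
      have arrs: "arr C Y Y ?bvi" "arr C Y Y ?wi" "arr C Y Y ?ti" using bv warr tarr ip by (auto intro: cmp_arr)
      have "ident C Y = (?bvi \<oplus>\<^bsub>Hom C Y Y\<^esub> ?wi) \<oplus>\<^bsub>Hom C Y Y\<^esub> ?ti"
        unfolding ip(4)[symmetric] t(2) using ip(1) bv warr tarr by (simp add: cmp_add_left)
      moreover have "?ti \<in> rad C Y Y" using t(1) ip(1) by (rule rad_cmp_right)
      ultimately have "?bvi \<oplus>\<^bsub>Hom C Y Y\<^esub> ?wi \<in> Units (End_ring C Y)"
        using arrs by (intro Units_End_if_ident_eq_add_rad[of Y _ ?ti]) auto
      then obtain c where c: "arr C Y Y c" "cmp C Y Y Y (?bvi \<oplus>\<^bsub>Hom C Y Y\<^esub> ?wi) c = ident C Y"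
        using obj Units_EndE by blast
      let ?z = "cmp C Y Y Y ?wi c"
      have "ident C Y = cmp C Y Z Y b (cmp C Y Y Z (cmp C Y S Z v i\<^sub>1) c) \<oplus>\<^bsub>Hom C Y Y\<^esub> ?z"
        unfolding c(2)[symmetric] using c(1) b v ip arrs by (simp add: cmp_add_left cmp_assoc cmp_arr)
      moreover have "?z \<in> I Y Y" using w(1) ip(1) c(1) obj by (intro ideal_cmp_right)
      moreover have "arr C Y Z (cmp C Y Y Z (cmp C Y S Z v i\<^sub>1) c)" using c v ip by (auto intro: cmp_arr)
      ultimately show "is_retraction (quot_cat C I) Z Y (coset C I Z Y b)"
        unfolding is_retraction_quot_iff[OF b] by blast
    qed
  qed
qed

text \<open>The second half of the equivalence, starting from a given minimal left almost split morphism.  The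
  complement \<open>Y'\<close> of \<open>Y\<close> in its target is zero in the quotient because there \<open>h\<close> factors through \<open>f\<close>
  and \<open>f\<close> through \<open>h\<close>, so that minimality leaves no room for more than \<open>Y\<close>.\<close>

lemma extend_to_minimal_left_almost_split:
  assumes f: "arr C X Y f"
    and irr: "irreducible_morphism (quot_cat C I) X Y (coset C I X Y f)"
    and las: "left_almost_split (quot_cat C I) X Y (coset C I X Y f)"
    and mlas: "minimal_left_almost_split C X S h"
    and radX: "I X X \<subseteq> rad C X X" and radY: "I Y Y \<subseteq> rad C Y Y"
  obtains Y' g i\<^sub>1 i\<^sub>2 p\<^sub>1 p\<^sub>2 where "arr C X Y' g" "ident C Y' \<in> I Y' Y'" "biproduct C Y Y' S i\<^sub>1 i\<^sub>2 p\<^sub>1 p\<^sub>2"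
    "h = cmp C X Y S i\<^sub>1 f \<oplus>\<^bsub>Hom C X S\<^esub> cmp C X Y' S i\<^sub>2 g"
proof -
  have min: "left_minimal C X S h" and h: "arr C X S h" and nsec: "\<not> is_section C X S h"
    and las_h: "\<And>U u. \<lbrakk>arr C X U u; \<not> is_section C X U u\<rbrakk> \<Longrightarrow> \<exists>v. arr C S U v \<and> u = cmp C X S U v h"
    using mlas unfolding minimal_left_almost_split_def left_almost_split_def by auto
  have obj: "X \<in> Obj C" "Y \<in> Obj C" "S \<in> Obj C" using f h by (auto simp: arr_def)
  have X: "ident C X \<notin> I X X" using not_left_almost_split_quot_if_ident_mem f las by blast
  note irr' = irr[unfolded irreducible_quot_iff[OF f]] and las' = las[unfolded left_almost_split_quot_iff[OF f]]
  have nsecq: "\<not> is_section (quot_cat C I) X S (coset C I X S h)"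
    using is_section_if_coset[OF h radX] nsec by blast
  have "\<not> is_section C X Y f" using irr' is_section_coset by blast
  then obtain v where v: "arr C S Y v" "f = cmp C X S Y v h" using las_h f by blast
  have "f = cmp C X S Y v h \<oplus>\<^bsub>Hom C X Y\<^esub> \<zero>\<^bsub>Hom C X Y\<^esub>" using v f by simp
  then have "is_retraction (quot_cat C I) S Y (coset C I S Y v)"
    using irr' h v(1) nsecq ideal_zero[OF obj(1,2)] by blast
  then obtain j where j: "arr C Y S j" "cmp C Y S Y v j = ident C Y"
    using is_retraction_if_coset[OF v(1) radY] by (auto simp: is_retraction_def)
  obtain Y' i p where b: "biproduct C Y Y' S j i v p" using retraction_complement[OF v(1) j] .
  then have ip: "arr C Y' S i" "arr C S Y' p" "cmp C Y' S Y' p i = ident C Y'"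
    "cmp C Y' S Y v i = \<zero>\<^bsub>Hom C Y' Y\<^esub>"
    "cmp C S Y S j v \<oplus>\<^bsub>Hom C S S\<^esub> cmp C S Y' S i p = ident C S"
    by (auto simp: biproduct_def)
  have objY': "Y' \<in> Obj C" using ip by (simp add: arr_def)
  have "h = cmp C X S S (cmp C S Y S j v \<oplus>\<^bsub>Hom C S S\<^esub> cmp C S Y' S i p) h"
    unfolding ip(5) using h by (simp add: cmp_ident_left)
  also have "\<dots> = cmp C X Y S j f \<oplus>\<^bsub>Hom C X S\<^esub> cmp C X Y' S i (cmp C X S Y' p h)"
    unfolding v(2) using h v(1) j(1) ip(1,2) by (simp add: cmp_add_left cmp_arr cmp_assoc)
  finally have h_eq: "h = cmp C X Y S j f \<oplus>\<^bsub>Hom C X S\<^esub> cmp C X Y' S i (cmp C X S Y' p h)" .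
  have "ident C Y' \<in> I Y' Y'"
  proof -
    obtain u z where u: "z \<in> I X S" "arr C Y S u" "h = cmp C X Y S u f \<oplus>\<^bsub>Hom C X S\<^esub> z"
      using las' h nsecq by blast
    obtain w where w: "w \<in> I S S" "z = cmp C X S S w h"
      using ideal_factors_minimal_left_almost_split[OF mlas X u(1) obj(3)] by blast
    have warr: "arr C S S w" using w obj ideal_arr by blast
    let ?uv = "cmp C S Y S u v"
    have uv: "arr C S S ?uv" using u v by (auto intro: cmp_arr)
    have "cmp C X S S (ident C S) h = cmp C X Y S u f \<oplus>\<^bsub>Hom C X S\<^esub> z"
      using u(3) h by (simp add: cmp_ident_left)
    also have "\<dots> = cmp C X S S (?uv \<oplus>\<^bsub>Hom C S S\<^esub> w) h"
      unfolding w(2) v(2) using h u(2) v(1) warr uv by (simp add: cmp_add_left cmp_assoc)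
    finally obtain t where t: "t \<in> rad C S S" "ident C S = (?uv \<oplus>\<^bsub>Hom C S S\<^esub> w) \<oplus>\<^bsub>Hom C S S\<^esub> t"
      using left_minimal_cancel[OF min ident_arr[OF obj(3)] add_arr[OF uv warr]] by blast
    note tarr = rad_arr[OF t(1)]
    let ?pwi = "cmp C Y' S Y' (cmp C S S Y' p w) i" and ?pti = "cmp C Y' S Y' (cmp C S S Y' p t) i"
    have arrs: "arr C Y' Y' ?pwi" "arr C Y' Y' ?pti" using ip warr tarr by (auto intro: cmp_arr)
    have uvi: "cmp C Y' S S ?uv i = \<zero>\<^bsub>Hom C Y' S\<^esub>"
      using u v ip objY' by (simp add: cmp_assoc[symmetric])
    have "ident C Y' = cmp C Y' S Y' p (cmp C Y' S S (ident C S) i)"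
      using ip by (simp add: cmp_ident_left)
    also have "\<dots> = cmp C Y' S Y' p (cmp C Y' S S ?uv i) \<oplus>\<^bsub>Hom C Y' Y'\<^esub> ?pwi \<oplus>\<^bsub>Hom C Y' Y'\<^esub> ?pti"
      unfolding t(2) using ip(1,2) uv warr tarr by (simp add: cmp_distribs cmp_arr cmp_assoc)
    also have "\<dots> = ?pwi \<oplus>\<^bsub>Hom C Y' Y'\<^esub> ?pti"
      unfolding uvi using ip(2) arrs objY' by simp
    finally have "?pwi \<in> Units (End_ring C Y')"
      using arrs t(1) ip by (intro Units_End_if_ident_eq_add_rad[of Y' _ ?pti] rad_cmp_left rad_cmp_right)
    moreover have "?pwi \<in> I Y' Y'"
      using w(1) ip(1,2) obj objY' by (intro ideal_cmp_right ideal_cmp_left)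
    ultimately show ?thesis using ident_in_ideal_iff[OF objY'] by blast
  qed
  moreover have "arr C X Y' (cmp C X S Y' p h)" using h ip by (auto intro: cmp_arr)
  ultimately show ?thesis using that b h_eq by blast
qed

end

theorem proposition4p18:
  fixes R :: "('k, 'r) ring_scheme" and C :: "('o, 'm, 'k) kcat"
    and I :: "'o \<Rightarrow> 'o \<Rightarrow> 'm set" and X Y :: 'o and f :: 'm
    and n m :: nat and Xs Ys :: "nat \<Rightarrow> 'o"
  assumes "right_AR_category R C"
    and "arr C X Y f"
    and "admissible_ideal R C I"
    and "direct_sum C X n Xs"
    and "\<forall>i\<in>{1..n}. indecomposable C (Xs i) \<and> ident C (Xs i) \<notin> I (Xs i) (Xs i)"
    and "direct_sum C Y m Ys" and "m \<ge> 1"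
    and "\<forall>j\<in>{1..m}. indecomposable C (Ys j) \<and> ident C (Ys j) \<notin> I (Ys j) (Ys j)"
  shows "irreducible_morphism (quot_cat C I) X Y (coset C I X Y f) \<and>
         left_almost_split (quot_cat C I) X Y (coset C I X Y f)
     \<longleftrightarrow> (\<exists>Y' g. arr C X Y' g \<and> ident C Y' \<in> I Y' Y' \<and>
           (\<exists>S i\<^sub>1 i\<^sub>2 p\<^sub>1 p\<^sub>2. biproduct C Y Y' S i\<^sub>1 i\<^sub>2 p\<^sub>1 p\<^sub>2 \<and>
              minimal_left_almost_split C X S
                (cmp C X Y S i\<^sub>1 f \<oplus>\<^bsub>Hom C X S\<^esub> cmp C X Y' S i\<^sub>2 g)))"
proof -
  interpret A: right_AR_category R C by (rule assms)
  interpret B: admissible_ideal_category R C I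
    by unfold_locales (rule assms)
  have radX: "I X X \<subseteq> rad C X X" and radY: "I Y Y \<subseteq> rad C Y Y"
    using B.ideal_subset_rad assms(4-8) by blast+
  have obj: "X \<in> Obj C" "Y \<in> Obj C" using assms(2) by (auto simp: arr_def)
  show ?thesis
  proof (intro iffI; (elim exE conjE)?)
    assume irr: "irreducible_morphism (quot_cat C I) X Y (coset C I X Y f)"
      and las: "left_almost_split (quot_cat C I) X Y (coset C I X Y f)"
    have "indecomposable C X"
      using B.indecomposable_if_left_almost_split_quot[OF assms(4,5,2) las] .
    then obtain S h where mlas: "minimal_left_almost_split C X S h"
      using A.right_AR unfolding pseudo_injective_def AR_sequence_def by blast
    obtain Y' g i\<^sub>1 i\<^sub>2 p\<^sub>1 p\<^sub>2 where "arr C X Y' g" "ident C Y' \<in> I Y' Y'" "biproduct C Y Y' S i\<^sub>1 i\<^sub>2 p\<^sub>1 p\<^sub>2"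
      "h = cmp C X Y S i\<^sub>1 f \<oplus>\<^bsub>Hom C X S\<^esub> cmp C X Y' S i\<^sub>2 g"
      using B.extend_to_minimal_left_almost_split[OF assms(2) irr las mlas radX radY] .
    then show "\<exists>Y' g. arr C X Y' g \<and> ident C Y' \<in> I Y' Y' \<and>
        (\<exists>S i\<^sub>1 i\<^sub>2 p\<^sub>1 p\<^sub>2. biproduct C Y Y' S i\<^sub>1 i\<^sub>2 p\<^sub>1 p\<^sub>2 \<and>
          minimal_left_almost_split C X S (cmp C X Y S i\<^sub>1 f \<oplus>\<^bsub>Hom C X S\<^esub> cmp C X Y' S i\<^sub>2 g))"
      using mlas by blast
  next
    fix Y' g S i\<^sub>1 i\<^sub>2 p\<^sub>1 p\<^sub>2
    assume g: "arr C X Y' g" "ident C Y' \<in> I Y' Y'" and S: "biproduct C Y Y' S i\<^sub>1 i\<^sub>2 p\<^sub>1 p\<^sub>2"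
      and mlas: "minimal_left_almost_split C X S (cmp C X Y S i\<^sub>1 f \<oplus>\<^bsub>Hom C X S\<^esub> cmp C X Y' S i\<^sub>2 g)"
    have Y: "ident C Y \<notin> I Y Y"
      using B.ident_eq_zero_if_ident_mem_ideal[OF assms(6)] assms(7,8) by auto
    have X: "ident C X \<notin> I X X"
    proof
      assume "ident C X \<in> I X X"
      then have 0: "ident C X = \<zero>\<^bsub>Hom C X X\<^esub>"
        using B.ident_eq_zero_if_ident_mem_ideal[OF assms(4)] assms(5) by blast
      let ?h = "cmp C X Y S i\<^sub>1 f \<oplus>\<^bsub>Hom C X S\<^esub> cmp C X Y' S i\<^sub>2 g"
      have h: "arr C X S ?h" "\<not> is_section C X S ?h"
        using mlas by (auto simp: minimal_left_almost_split_def left_almost_split_def)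
      then have "S \<in> Obj C" by (simp add: arr_def)
      then have "cmp C X S X \<zero>\<^bsub>Hom C S X\<^esub> ?h = ident C X" using h(1) obj 0 by simp
      then show False using h obj \<open>S \<in> Obj C\<close> A.zero_arr unfolding is_section_def by blast
    qed
    show "irreducible_morphism (quot_cat C I) X Y (coset C I X Y f) \<and>
        left_almost_split (quot_cat C I) X Y (coset C I X Y f)"
      using B.irreducible_left_almost_split_quot[OF assms(2) g S mlas radX radY X Y] by blast
  qed
qed

end
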